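(* For $N\ge 3$ let $A_{\mathrm{nest}}^{(N)},A_{\mathrm{sw}}^{(N)}\in\mathbb R^{N\times N}$ be given by $[A_{\mathrm{nest}}^{(N)}]_{ij}=1$ if $j\le i$ and $0$ otherwise, and $[A_{\mathrm{sw}}^{(N)}]_{ij}=1$ if $j\in\{i-1,i\}$ and $0$ otherwise. Then the following hold. (a) $A_{\mathrm{sw}}^{(N)}$ is the Toeplitz matrix generated by $f_1(\theta)=1+e^{\mathrm i\theta}$, $\theta\in[-\pi,\pi]$; therefore $$\left\{A_{\mathrm{sw}}^{(N)}\right\}_N\sim_{\mathrm{GLT}}1+e^{\mathrm i\theta},\qquad\text{and consequently}\qquad \left\{A_{\mathrm{sw}}^{(N)}\right\}_N\sim_\sigma 1+e^{\mathrm i\theta}.$$ (b) $\left(A_{\mathrm{nest}}^{(N)}\right)^{-1}$ is the Toeplitz matrix generated by $f_2(\theta)=1-e^{\mathrm i\theta}$, $\theta\in[-\pi,\pi]$, so that $$\left\{\left(A_{\mathrm{nest}}^{(N)}\right)^{-1}\right\}_N\sim_{\mathrm{GLT}}1-e^{\mathrm i\theta}.$$ (c) Since $1-e^{\mathrm i\theta}$ vanishes only at $\theta=0$, it is nonzero almost everywhere, and hence $$\left\{A_{\mathrm{nest}}^{(N)}\right\}_N\sim_{\mathrm{GLT}}\frac{1}{1-e^{\mathrm i\theta}},\qquad\text{and therefore}\qquad \left\{A_{\mathrm{nest}}^{(N)}\right\}_N\sim_\sigma\frac{1}{1-e^{\mathrm i\theta}}.$$ (d) The corresponding nonnegative singular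 value symbols of $\{A_{\mathrm{sw}}^{(N)}\}_N$ and $\{A_{\mathrm{nest}}^{(N)}\}_N$ are, respectively, $$\left|1+e^{\mathrm i\theta}\right|=2\left|\cos\left(\tfrac{\theta}{2}\right)\right|\qquad\text{and}\qquad \left|\frac{1}{1-e^{\mathrm i\theta}}\right|=\frac{1}{2\left|\sin\left(\tfrac{\theta}{2}\right)\right|}.$$
   Context: The matrices are interval-cell incidence matrices for a grid $x_0<x_1<\cdots<x_N$: entry $(i,j)$ is $1$ if the cell $[x_{j-1},x_j]$ is contained in the $i$-th interval and $0$ otherwise. $A_{\mathrm{nest}}^{(N)}$ corresponds to the nested intervals $[x_0,x_i]$, $i=1,\ldots,N$, and $A_{\mathrm{sw}}^{(N)}$ to the supplemented sliding-window family $[x_0,x_1]$, $[x_{i-2},x_i]$, $i=2,\ldots,N$. The $N\times N$ Toeplitz matrix generated by $f\in L^1(-\pi,\pi)$ is $T_N(f)=[\hat f_{i-j}]_{i,j=1}^N$ with $\hat f_k=\frac1{2\pi}\int_{-\pi}^{\pi}f(\theta)e^{-\mathrm i k\theta}\,d\theta$. For matrices $A_N\in\mathbb C^{N\times N}$ with singular values $\sigma_1(A_N),\ldots,\sigma_N(A_N)$ and a measurable function $f$ defined almost everywhere on $[-\pi,\pi]$, the notation $\{A_N\}_N\sim_\sigma f$ means that for every continuous compactly supported $F:\mathbb R\to\mathbb C$, $$\lim_{N\to\infty}\frac1N\sum_{j=1}^N F(\sigma_j(A_N))=\frac{1}{2\pi}\int_{-\pi}^{\pi}F(|f(\theta)|)\,d\theta.$$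 The notation $\{A_N\}_N\sim_{\mathrm{GLT}}\kappa$ means that $\{A_N\}_N$ is a generalized locally Toeplitz (GLT) sequence with symbol $\kappa$, in the standard sense of the theory of GLT sequences (Garoni and Serra-Capizzano). Here $\kappa$ is in general a measurable function on $[0,1]\times[-\pi,\pi]$; a function of $\theta$ alone is regarded as constant in the first variable. Equivalently, the pair $(\{A_N\}_N,\kappa)$ belongs to the closure of the algebra of pairs generated by $(\{T_N(e^{\mathrm i\theta})\}_N,e^{\mathrm i\theta})$, its adjoint pair $(\{T_N(e^{-\mathrm i\theta})\}_N,e^{-\mathrm i\theta})$, and the pairs $(\{\operatorname{diag}_{i=1,\ldots,N}a(i/N)\}_N,a(x))$ with $a\in C^\infty([0,1])$. The closure is taken with respect to approximating-class-of-sequences convergence for the matrix sequences and convergence in measure for the symbols. *)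

theory Defs
  imports
    "HOL-Analysis.Analysis"
    "Jordan_Normal_Form.Schur_Decomposition"
    "Jordan_Normal_Form.Gauss_Jordan_Elimination"
    "Jordan_Normal_Form.DL_Rank"
begin

text \<open>
  Matrices have a size that varies along a sequence, so they are of type \<^typ>\<open>complex mat\<close>
  (or \<^typ>\<open>real mat\<close>) and a matrix sequence is a function of \<open>N\<close> whose value at \<open>N\<close> is
  \<open>N \<times> N\<close>. Indices start at 0 instead of 1. Asymptotic notions do not depend on
  finitely many values of \<open>N\<close>, so all sequences are indexed by all natural numbers.
\<close>

definition nest_mat :: "nat \<Rightarrow> real mat" where
  "nest_mat N = Matrix.mat N N (\<lambda>(i, j). if j \<le> i then 1 else 0)"

definition sw_mat :: "nat \<Rightarrow> real mat" where
  "sw_mat N = Matrix.mat N N (\<lambda>(i, j). if j + 1 = i \<or> j = i then 1 else 0)"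

abbreviation cmat :: "real mat \<Rightarrow> complex mat" where
  "cmat \<equiv> map_mat complex_of_real"

text \<open>Meaningful for invertible matrices only: \<^const>\<open>mat_inverse\<close> returns an option.\<close>

definition mat_inv :: "'a::field mat \<Rightarrow> 'a mat" where
  "mat_inv A = the (mat_inverse A)"


definition fourier_coeff :: "(real \<Rightarrow> complex) \<Rightarrow> int \<Rightarrow> complex" where
  "fourier_coeff f k =
     complex_of_real (1 / (2 * pi)) *
       (LINT \<theta>:{-pi..pi}|lebesgue. f \<theta> * cis (- (of_int k * \<theta>)))"

definition toeplitz_mat :: "nat \<Rightarrow> (real \<Rightarrow> complex) \<Rightarrow> complex mat" where
  "toeplitz_mat N f = Matrix.mat N N (\<lambda>(i, j). fourier_coeff f (int i - int j))"


text \<open>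
  The square roots of the eigenvalues of \<open>A\<^sup>* A\<close>, counted with (algebraic) multiplicity. These
  eigenvalues are real and nonnegative, so taking the real part only changes the type.
\<close>

definition singular_values :: "complex mat \<Rightarrow> real multiset" where
  "singular_values A =
     image_mset (\<lambda>z. sqrt (Re z)) (proots (char_poly (mat_adjoint A * A)))"

definition matrix_seq :: "(nat \<Rightarrow> complex mat) \<Rightarrow> bool" where
  "matrix_seq A \<longleftrightarrow> (\<forall>N. A N \<in> carrier_mat N N)"

definition sv_distributed :: "(nat \<Rightarrow> complex mat) \<Rightarrow> (real \<Rightarrow> complex) \<Rightarrow> bool"
  (infix \<open>\<sim>\<^sub>\<sigma>\<close> 50) where
  "A \<sim>\<^sub>\<sigma> f \<longleftrightarrow>
     matrix_seq A \<and> f \<in> borel_measurable (lebesgue_on {-pi..pi}) \<and>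
     (\<forall>F :: real \<Rightarrow> complex.
        continuous_on UNIV F \<and> compact (closure {x. F x \<noteq> 0}) \<longrightarrow>
        (\<lambda>N. (1 / of_nat N) * (\<Sum>\<sigma>\<in>#singular_values (A N). F \<sigma>))
          \<longlonglongrightarrow> complex_of_real (1 / (2 * pi)) *
                (LINT \<theta>:{-pi..pi}|lebesgue. F (cmod (f \<theta>))))"


definition vec_norm2 :: "complex Matrix.vec \<Rightarrow> real" where
  "vec_norm2 v = sqrt (\<Sum>i<dim_vec v. (cmod (vec_index v i))\<^sup>2)"

definition spectral_norm :: "complex mat \<Rightarrow> real" where
  "spectral_norm A =
     Sup ((\<lambda>v. vec_norm2 (A *\<^sub>v v)) ` {v \<in> carrier_vec (dim_col A). vec_norm2 v \<le> 1})"

text \<open>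
  The sequence \<open>m \<mapsto> B m\<close> of matrix sequences is an approximating class of sequences for \<open>A\<close>;
  the bound \<open>Nm m\<close> and the rates \<open>c m\<close>, \<open>\<omega> m\<close> depend on \<open>m\<close> only.
\<close>

definition acs_convergent :: "(nat \<Rightarrow> nat \<Rightarrow> complex mat) \<Rightarrow> (nat \<Rightarrow> complex mat) \<Rightarrow> bool" where
  "acs_convergent B A \<longleftrightarrow>
     (\<exists>(Nm :: nat \<Rightarrow> nat) (c :: nat \<Rightarrow> real) (\<omega> :: nat \<Rightarrow> real).
        c \<longlonglongrightarrow> 0 \<and> \<omega> \<longlonglongrightarrow> 0 \<and>
        (\<forall>m. \<forall>N \<ge> Nm m.
           \<exists>R \<in> carrier_mat N N. \<exists>E \<in> carrier_mat N N.
             A N = B m N + R + E \<and>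
             real (vec_space.rank N R) \<le> c m * real N \<and>
             spectral_norm E \<le> \<omega> m))"

definition tendsto_in_measure ::
  "'a measure \<Rightarrow> (nat \<Rightarrow> 'a \<Rightarrow> complex) \<Rightarrow> ('a \<Rightarrow> complex) \<Rightarrow> bool" where
  "tendsto_in_measure M f g \<longleftrightarrow>
     (\<forall>n. f n \<in> borel_measurable M) \<and> g \<in> borel_measurable M \<and>
     (\<forall>\<epsilon>>0. (\<lambda>n. emeasure M {z \<in> space M. \<epsilon> < dist (f n z) (g z)}) \<longlonglongrightarrow> 0)"

text \<open>
  \<open>C\<^sup>\<infinity>([0,1])\<close>: derivatives of all orders exist on the closed interval, one-sided at the end
  points. The values of \<open>a\<close> outside of \<open>[0,1]\<close> play no role.
\<close>

definition smooth_unit_interval :: "(real \<Rightarrow> complex) \<Rightarrow> bool" where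
  "smooth_unit_interval a \<longleftrightarrow>
     (\<exists>d :: nat \<Rightarrow> real \<Rightarrow> complex. d 0 = a \<and>
        (\<forall>k. \<forall>x\<in>{0..1}. (d k has_vector_derivative d (Suc k) x) (at x within {0..1})))"

text \<open>The complex algebra of pairs (matrix sequence, symbol) with entrywise operations on pairs.\<close>

inductive glt_algebra :: "(nat \<Rightarrow> complex mat) \<Rightarrow> (real \<times> real \<Rightarrow> complex) \<Rightarrow> bool" where
  shift: "glt_algebra (\<lambda>N. toeplitz_mat N (\<lambda>\<theta>. cis \<theta>)) (\<lambda>(x, \<theta>). cis \<theta>)"
| shift_adjoint: "glt_algebra (\<lambda>N. toeplitz_mat N (\<lambda>\<theta>. cis (- \<theta>))) (\<lambda>(x, \<theta>). cis (- \<theta>))"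
| diagonal: "smooth_unit_interval a \<Longrightarrow>
    glt_algebra (\<lambda>N. mat_diag N (\<lambda>i. a (real (i + 1) / real N))) (\<lambda>(x, \<theta>). a x)"
| add: "glt_algebra A \<kappa> \<Longrightarrow> glt_algebra B \<xi> \<Longrightarrow>
    glt_algebra (\<lambda>N. A N + B N) (\<lambda>z. \<kappa> z + \<xi> z)"
| scale: "glt_algebra A \<kappa> \<Longrightarrow>
    glt_algebra (\<lambda>N. s \<cdot>\<^sub>m A N) (\<lambda>z. s * \<kappa> z)"
| mult: "glt_algebra A \<kappa> \<Longrightarrow> glt_algebra B \<xi> \<Longrightarrow>
    glt_algebra (\<lambda>N. A N * B N) (\<lambda>z. \<kappa> z * \<xi> z)"

text \<open>
  Both a.c.s. convergence and convergence in measure are induced by pseudometrics, so the closure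
  of the algebra consists of the limits of sequences of its elements.
\<close>

definition glt :: "(nat \<Rightarrow> complex mat) \<Rightarrow> (real \<times> real \<Rightarrow> complex) \<Rightarrow> bool"
  (infix \<open>\<sim>\<^sub>G\<^sub>L\<^sub>T\<close> 50) where
  "A \<sim>\<^sub>G\<^sub>L\<^sub>T \<kappa> \<longleftrightarrow>
     matrix_seq A \<and>
     (\<exists>B \<xi>. (\<forall>m. glt_algebra (B m) (\<xi> m)) \<and> acs_convergent B A \<and>
        tendsto_in_measure (lebesgue_on ({0..1} \<times> {-pi..pi})) \<xi> \<kappa>)"

end

theory Submission
  imports Defs "HOL-Computational_Algebra.Polynomial_FPS" "HOL-Real_Asymp.Real_Asymp"
begin

text \<open>
  Both families are images of power series in the lower shift: \<open>1 + X\<close> for the sliding windows,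
  \<open>1 / (1 - X)\<close> for the nested intervals, and \<open>1 - X\<close> for the inverse of the latter
  (\<open>fps_toeplitz_mult\<close>). The two polynomial cases belong to the GLT algebra itself
  (\<open>glt_algebra_poly\<close>).

  For the nested matrices \<open>A\<close>, the polynomials \<open>p\<^sub>K\<close> of Cesaro means of the geometric series satisfy
  \<open>1 / (1 - X) - p\<^sub>K = (X - X\<^bsup>K+1\<^esup>) / (K (1 - X)\<^sup>2)\<close>. On the unit circle this tends to \<open>0\<close> away
  from \<open>1\<close>, hence in measure. For matrices it says that \<open>A - p\<^sub>K\<close> is \<open>A\<^sup>2\<close> times a matrix of norm
  at most \<open>2 / K\<close>. Although \<open>A\<close> has norm of order \<open>N\<close>, cutting its indices into blocks of length
  \<open>L\<close> writes \<open>A\<close> as a matrix of rank about \<open>N / L\<close> plus a matrix of norm at most \<open>L\<close>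
  (\<open>ones_block_split\<close>). Hence \<open>A - p\<^sub>K\<close> has norm at most \<open>2 L\<^sup>2 / K\<close> up to a rank of about
  \<open>2 N / L\<close>, and \<open>K = L\<^sup>3\<close> yields approximating classes of sequences (\<open>acs_convergent_ones\<close>).

  The singular value distributions follow from explicit singular values. These are
  \<open>2 cos (\<phi> / 2)\<close> with \<open>\<phi> = 2 k \<pi> / (2 N + 1)\<close> for the sliding windows and
  \<open>1 / (2 sin (\<phi> / 2))\<close> with \<open>\<phi> = (2 k - 1) \<pi> / (2 N + 1)\<close> for the nested intervals,
  \<open>k = 1, \<dots>, N\<close> (\<open>singular_values_sw\<close>, \<open>singular_values_nest\<close>). The average of a test function
  over them is a Riemann sum of a continuous function (\<open>riemann_sum_tendsto\<close>), also for the
  unbounded nested symbol, because a test function of compact support vanishes near its pole.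
\<close>

section \<open>Lower triangular Toeplitz matrices as images of power series\<close>

text \<open>
  Sending the formal variable to the lower shift matrix sends a formal power series to the lower
  triangular Toeplitz matrix of its coefficients. This map is a ring homomorphism, so that the
  matrix identities below are identities of power series: the nested matrix is the image of
  \<open>1 / (1 - X)\<close>, its inverse that of \<open>1 - X\<close>, and the sliding-window matrix that of \<open>1 + X\<close>.
\<close>

definition fps_toeplitz :: "nat \<Rightarrow> 'a::comm_ring_1 fps \<Rightarrow> 'a mat" where
  "fps_toeplitz N f = Matrix.mat N N (\<lambda>(i, j). if j \<le> i then fps_nth f (i - j) else 0)"

lemma fps_toeplitz_carrier [simp]: "fps_toeplitz N f \<in> carrier_mat N N"
  and dim_fps_toeplitz [simp]: "dim_row (fps_toeplitz N f) = N" "dim_col (fps_toeplitz N f) = N"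
  by (auto simp: fps_toeplitz_def)

lemma fps_toeplitz_index [simp]:
  "i < N \<Longrightarrow> j < N \<Longrightarrow> fps_toeplitz N f $$ (i, j) = (if j \<le> i then fps_nth f (i - j) else 0)"
  by (simp add: fps_toeplitz_def)

lemma fps_toeplitz_1: "fps_toeplitz N 1 = 1\<^sub>m N"
  by (rule eq_matI) auto

lemma fps_toeplitz_add: "fps_toeplitz N (f + g) = fps_toeplitz N f + fps_toeplitz N g"
  by (rule eq_matI) auto

lemma fps_toeplitz_mult: "fps_toeplitz N (f * g) = fps_toeplitz N f * fps_toeplitz N g"
proof (rule eq_matI)
  fix i j assume "i < dim_row (fps_toeplitz N f * fps_toeplitz N g)"
    and "j < dim_col (fps_toeplitz N f * fps_toeplitz N g)"
  then have ij: "i < N" "j < N" by auto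
  have "(fps_toeplitz N f * fps_toeplitz N g) $$ (i, j) =
      (\<Sum>k<N. fps_toeplitz N f $$ (i, k) * fps_toeplitz N g $$ (k, j))"
    using ij by (simp add: scalar_prod_def atLeast0LessThan)
  also have "\<dots> = (\<Sum>k | k < N \<and> j \<le> k \<and> k \<le> i. fps_nth f (i - k) * fps_nth g (k - j))"
    using ij by (intro sum.mono_neutral_cong_right) auto
  also have "\<dots> = fps_toeplitz N (f * g) $$ (i, j)"
  proof (cases "j \<le> i")
    case True
    have "(\<Sum>k | k < N \<and> j \<le> k \<and> k \<le> i. fps_nth f (i - k) * fps_nth g (k - j)) =
       (\<Sum>k=0..i - j. fps_nth f k * fps_nth g (i - j - k))"
      by (rule sum.reindex_bij_witness[of _ "\<lambda>k. i - k" "\<lambda>k. i - k"]) (use True ij in auto)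
    then show ?thesis using True ij by (simp add: fps_mult_nth)
  next
    case False
    then have "{k. k < N \<and> j \<le> k \<and> k \<le> i} = {}" by auto
    then show ?thesis using False ij by (simp del: Collect_empty_eq)
  qed
  finally show "fps_toeplitz N (f * g) $$ (i, j) = (fps_toeplitz N f * fps_toeplitz N g) $$ (i, j)" ..
qed auto

definition fps_ones :: "'a::comm_ring_1 fps" where
  "fps_ones = Abs_fps (\<lambda>_. 1)"

lemma one_minus_X_fps_ones: "(1 - fps_X) * fps_ones = (1 :: 'a::comm_ring_1 fps)"
  by (rule fps_ext) (auto simp: fps_ones_def left_diff_distrib)

lemma nest_mat_eq: "nest_mat N = fps_toeplitz N fps_ones"
  by (rule eq_matI) (auto simp: nest_mat_def fps_ones_def)

lemma cmat_nest_mat_eq: "cmat (nest_mat N) = fps_toeplitz N fps_ones"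
  by (rule eq_matI) (auto simp: nest_mat_def fps_ones_def)

lemma cmat_sw_mat_eq: "cmat (sw_mat N) = fps_toeplitz N (1 + fps_X)"
  by (rule eq_matI) (auto simp: sw_mat_def fps_X_def)

lemma mat_inv_eqI:
  fixes A B :: "'a::field mat"
  assumes A: "A \<in> carrier_mat n n" and B: "B \<in> carrier_mat n n" and inv: "A * B = 1\<^sub>m n" "B * A = 1\<^sub>m n"
  shows "mat_inv A = B"
proof (cases "mat_inverse A")
  case None
  from mat_inverse(1)[OF A this, of undefined] A B inv show ?thesis
    by (auto simp: Units_def ring_mat_def)
next
  case (Some C)
  from mat_inverse(2)[OF A Some] have C: "C * A = 1\<^sub>m n" "C \<in> carrier_mat n n" by auto
  have "C = C * (A * B)" using C unfolding inv by simp
  also have "\<dots> = C * A * B" by (rule assoc_mult_mat[OF C(2) A B, symmetric])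
  also have "\<dots> = B" using B unfolding C by simp
  finally show ?thesis using Some by (simp add: mat_inv_def)
qed

lemma nest_mat_inverse:
  shows "nest_mat N * fps_toeplitz N (1 - fps_X) = 1\<^sub>m N" "fps_toeplitz N (1 - fps_X) * nest_mat N = 1\<^sub>m N"
proof -
  show "fps_toeplitz N (1 - fps_X) * nest_mat N = 1\<^sub>m N"
    by (simp only: nest_mat_eq fps_toeplitz_mult[symmetric] one_minus_X_fps_ones fps_toeplitz_1)
  have "fps_ones * (1 - fps_X) = (1 :: real fps)"
    by (simp add: one_minus_X_fps_ones mult.commute[of fps_ones])
  then show "nest_mat N * fps_toeplitz N (1 - fps_X) = 1\<^sub>m N"
    by (simp only: nest_mat_eq fps_toeplitz_mult[symmetric] fps_toeplitz_1)
qed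

lemma invertible_nest_mat: "invertible_mat (nest_mat N)"
  using nest_mat_inverse[of N] 
  by (auto simp: invertible_mat_def inverts_mat_def nest_mat_eq intro!: exI[of _ "fps_toeplitz N (1 - fps_X)"])

lemma cmat_mat_inv_nest_mat: "cmat (mat_inv (nest_mat N)) = fps_toeplitz N (1 - fps_X)"
proof -
  have "mat_inv (nest_mat N) = fps_toeplitz N (1 - fps_X)"
    by (rule mat_inv_eqI[OF _ _ nest_mat_inverse]) (auto simp: nest_mat_def)
  then show ?thesis
    by (intro eq_matI) (auto simp: fps_X_def)
qed

section \<open>Fourier coefficients of linear symbols\<close>

lemma set_integrable_cis: "set_integrable lebesgue {-pi..pi} (\<lambda>\<theta>. cis (of_int n * \<theta>))"
proof -
  have "set_integrable lborel {-pi..pi} (\<lambda>\<theta>. cis (of_int n * \<theta>))"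
    unfolding set_integrable_def by (intro borel_integrable_compact continuous_intros) simp
  then show ?thesis
    unfolding set_integrable_def by (subst integrable_completion) (auto simp: borel_measurable_integrable)
qed

lemma integral_cis:
  "(LINT \<theta>:{-pi..pi}|lebesgue. cis (of_int n * \<theta>)) = (if n = 0 then of_real (2 * pi) else 0)"
proof -
  have "((\<lambda>\<theta>. cis (of_int n * \<theta>)) has_integral (if n = 0 then of_real (2 * pi) else 0)) {-pi..pi}"
  proof (cases "n = 0")
    case True
    then show ?thesis
      using has_integral_const_real[of "1 :: complex" "-pi" pi] by (simp add: scaleR_conv_of_real)
  next
    case False
    let ?F = "\<lambda>\<theta>. cis (of_int n * \<theta>) / (\<i> * of_int n)"
    have "(?F has_vector_derivative cis (of_int n * \<theta>)) (at \<theta> within {-pi..pi})" for \<theta>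
    proof -
      have "((\<lambda>z. exp (c * z) / c) has_field_derivative exp (c * of_real \<theta>)) (at (of_real \<theta>))"
        if "c \<noteq> 0" for c :: complex
        using that by (auto intro!: derivative_eq_intros)
      from has_vector_derivative_real_field[OF this[of "\<i> * of_int n"]] show ?thesis
        using False by (simp add: cis_conv_exp has_vector_derivative_at_within mult.assoc)
    qed
    then have "((\<lambda>\<theta>. cis (of_int n * \<theta>)) has_integral (?F pi - ?F (-pi))) {-pi..pi}"
      by (intro fundamental_theorem_of_calculus) auto
    moreover have "cis (of_int n * pi) = cis (of_int n * (-pi))"
      using sin_npi_int[of n] by (simp add: complex_eq_iff mult.commute)
    ultimately show ?thesis using False by simp
  qed
  then show ?thesis
    using set_lebesgue_integral_eq_integral(2)[OF set_integrable_cis[of n]] by (simp add: integral_unique)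
qed

lemma fourier_coeff_linear_symbol:
  "fourier_coeff (\<lambda>\<theta>. a + b * cis \<theta>) k = (if k = 0 then a else if k = 1 then b else 0)"
proof -
  have int: "set_integrable lebesgue {-pi..pi} (\<lambda>\<theta>. c * cis (of_int n * \<theta>))" for n c
    by (intro set_integrable_mult_right set_integrable_cis)
  have "(\<lambda>\<theta>. (a + b * cis \<theta>) * cis (- (of_int k * \<theta>))) =
      (\<lambda>\<theta>. a * cis (of_int (-k) * \<theta>) + b * cis (of_int (1 - k) * \<theta>))"
    by (simp add: fun_eq_iff distrib_right cis_mult algebra_simps)
  then have "fourier_coeff (\<lambda>\<theta>. a + b * cis \<theta>) k = of_real (1 / (2 * pi)) *
     (a * (if k = 0 then of_real (2 * pi) else 0) + b * (if k = 1 then of_real (2 * pi) else 0))"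
    unfolding fourier_coeff_def using int[of a "-k"] int[of b "1 - k"]
    by (simp add: set_integral_add integral_cis del: of_int_minus of_int_diff of_real_mult)
  then show ?thesis by simp
qed

lemma toeplitz_mat_linear_symbol:
  "toeplitz_mat N (\<lambda>\<theta>. a + b * cis \<theta>) = fps_toeplitz N (fps_const a + fps_const b * fps_X)"
  by (rule eq_matI) (auto simp: toeplitz_mat_def fourier_coeff_linear_symbol fps_X_def)

section \<open>Schur bounds and rank bounds\<close>

text \<open>
  A common bound on the absolute row and column sums is a convenient substitute for a bound on the
  spectral norm: it can be read off the entries, and it is submultiplicative.
\<close>

definition schur_bounded :: "complex mat \<Rightarrow> real \<Rightarrow> bool" where
  "schur_bounded A c \<longleftrightarrow>
     (\<forall>i<dim_row A. (\<Sum>j<dim_col A. cmod (A $$ (i, j))) \<le> c) \<and>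
     (\<forall>j<dim_col A. (\<Sum>i<dim_row A. cmod (A $$ (i, j))) \<le> c)"

lemma schur_bounded_mult:
  assumes A: "schur_bounded A c" and B: "schur_bounded B d" and dim: "dim_col A = dim_row B"
    and "0 \<le> c" "0 \<le> d"
  shows "schur_bounded (A * B) (c * d)"
  unfolding schur_bounded_def
proof (intro conjI allI impI)
  let ?m = "dim_row A" and ?n = "dim_row B" and ?p = "dim_col B"
  have entry: "cmod ((A * B) $$ (i, j)) \<le> (\<Sum>k<?n. cmod (A $$ (i, k)) * cmod (B $$ (k, j)))"
    if "i < ?m" "j < ?p" for i j
  proof -
    have "(A * B) $$ (i, j) = (\<Sum>k<?n. A $$ (i, k) * B $$ (k, j))"
      using that dim by (simp add: scalar_prod_def atLeast0LessThan)
    then show ?thesis by (simp add: sum_norm_le norm_mult)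
  qed
  { fix i assume "i < dim_row (A * B)"
    then have i: "i < ?m" by simp
    have "(\<Sum>j<?p. cmod ((A * B) $$ (i, j))) \<le>
        (\<Sum>j<?p. \<Sum>k<?n. cmod (A $$ (i, k)) * cmod (B $$ (k, j)))"
      using entry i by (intro sum_mono) auto
    also have "\<dots> = (\<Sum>k<?n. cmod (A $$ (i, k)) * (\<Sum>j<?p. cmod (B $$ (k, j))))"
      by (subst sum.swap) (simp add: sum_distrib_left)
    also have "\<dots> \<le> (\<Sum>k<?n. cmod (A $$ (i, k)) * d)"
      using B by (intro sum_mono mult_left_mono) (auto simp: schur_bounded_def)
    also have "\<dots> \<le> c * d"
      using A i dim \<open>0 \<le> d\<close> unfolding sum_distrib_right[symmetric]
      by (intro mult_right_mono) (auto simp: schur_bounded_def)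
    finally show "(\<Sum>j<dim_col (A * B). cmod ((A * B) $$ (i, j))) \<le> c * d" by simp }
  { fix j assume "j < dim_col (A * B)"
    then have j: "j < ?p" by simp
    have "(\<Sum>i<?m. cmod ((A * B) $$ (i, j))) \<le>
        (\<Sum>i<?m. \<Sum>k<?n. cmod (A $$ (i, k)) * cmod (B $$ (k, j)))"
      using entry j by (intro sum_mono) auto
    also have "\<dots> = (\<Sum>k<?n. (\<Sum>i<?m. cmod (A $$ (i, k))) * cmod (B $$ (k, j)))"
      by (subst sum.swap) (simp add: sum_distrib_right)
    also have "\<dots> \<le> (\<Sum>k<?n. c * cmod (B $$ (k, j)))"
      using A dim by (intro sum_mono mult_right_mono) (auto simp: schur_bounded_def)
    also have "\<dots> \<le> c * d"
      using B j \<open>0 \<le> c\<close> unfolding sum_distrib_left[symmetric]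
      by (intro mult_left_mono) (auto simp: schur_bounded_def)
    finally show "(\<Sum>i<dim_row (A * B). cmod ((A * B) $$ (i, j))) \<le> c * d" by simp }
qed

text \<open>
  The Schur test. The weight \<open>\<bar>a\<^sub>i\<^sub>j\<bar>\<close> is divided evenly between the two factors of the
  Cauchy--Schwarz inequality; one factor is then a row sum, and summation over \<open>i\<close> turns the other
  one into column sums.
\<close>

lemma spectral_norm_le_schur:
  assumes A: "schur_bounded A c" and c: "0 \<le> c"
  shows "spectral_norm A \<le> c"
  unfolding spectral_norm_def
proof (rule cSup_least)
  have "0\<^sub>v (dim_col A) \<in> {v \<in> carrier_vec (dim_col A). vec_norm2 v \<le> 1}"
    by (simp add: vec_norm2_def)
  then show "(\<lambda>v. vec_norm2 (A *\<^sub>v v)) ` {v \<in> carrier_vec (dim_col A). vec_norm2 v \<le> 1} \<noteq> {}"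
    by blast
next
  fix x assume "x \<in> (\<lambda>v. vec_norm2 (A *\<^sub>v v)) ` {v \<in> carrier_vec (dim_col A). vec_norm2 v \<le> 1}"
  then obtain v where v: "v \<in> carrier_vec (dim_col A)" "vec_norm2 v \<le> 1" and x: "x = vec_norm2 (A *\<^sub>v v)"
    by auto
  let ?m = "dim_row A" and ?n = "dim_col A"
  define a where "a i j = cmod (A $$ (i, j))" for i j
  define w where "w j = cmod (vec_index v j)" for j
  have a0: "0 \<le> a i j" for i j by (simp add: a_def)
  have row: "(cmod (vec_index (A *\<^sub>v v) i))\<^sup>2 \<le> c * (\<Sum>j<?n. a i j * (w j)\<^sup>2)" if i: "i < ?m" for i
  proof -
    have "cmod (vec_index (A *\<^sub>v v) i) \<le> (\<Sum>j<?n. a i j * w j)"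
      using i v by (auto simp: scalar_prod_def atLeast0LessThan a_def w_def norm_mult intro!: sum_norm_le)
    also have "\<dots> = (\<Sum>j<?n. sqrt (a i j) * (sqrt (a i j) * w j))"
      using a0 by (simp add: mult.assoc[symmetric])
    finally have "(cmod (vec_index (A *\<^sub>v v) i))\<^sup>2 \<le> (\<Sum>j<?n. sqrt (a i j) * (sqrt (a i j) * w j))\<^sup>2"
      by (intro power_mono) auto
    also have "\<dots> \<le> (\<Sum>j<?n. (sqrt (a i j))\<^sup>2) * (\<Sum>j<?n. (sqrt (a i j) * w j)\<^sup>2)"
      by (rule Cauchy_Schwarz_ineq_sum)
    also have "\<dots> = (\<Sum>j<?n. a i j) * (\<Sum>j<?n. a i j * (w j)\<^sup>2)"
      using a0 by (simp add: power_mult_distrib)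
    also have "\<dots> \<le> c * (\<Sum>j<?n. a i j * (w j)\<^sup>2)"
      using A i a0 by (intro mult_right_mono sum_nonneg) (auto simp: schur_bounded_def a_def)
    finally show ?thesis .
  qed
  have "(\<Sum>i<?m. (cmod (vec_index (A *\<^sub>v v) i))\<^sup>2) \<le> (\<Sum>i<?m. c * (\<Sum>j<?n. a i j * (w j)\<^sup>2))"
    using row by (intro sum_mono) auto
  also have "\<dots> = c * (\<Sum>j<?n. (\<Sum>i<?m. a i j) * (w j)\<^sup>2)"
    by (subst sum_distrib_left[symmetric], subst sum.swap) (simp add: sum_distrib_right)
  also have "\<dots> \<le> c * (\<Sum>j<?n. c * (w j)\<^sup>2)"
    using A c by (intro mult_left_mono sum_mono mult_right_mono) (auto simp: schur_bounded_def a_def)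
  also have "\<dots> = c\<^sup>2 * (\<Sum>j<?n. (w j)\<^sup>2)"
    by (simp add: sum_distrib_left power2_eq_square mult.assoc)
  also have "\<dots> \<le> c\<^sup>2 * 1"
    using v by (intro mult_left_mono) (auto simp: vec_norm2_def w_def)
  finally have "x \<le> sqrt (c\<^sup>2)"
    unfolding x vec_norm2_def by (simp only: dim_mult_mat_vec real_sqrt_le_iff mult_1_right)
  then show "x \<le> c" using c by simp
qed

lemma schur_bounded_fps_toeplitz:
  assumes f: "(\<Sum>k<N. cmod (fps_nth f k)) \<le> c"
  shows "schur_bounded (fps_toeplitz N f) c"
proof -
  have "(\<Sum>j<N. cmod (fps_toeplitz N f $$ (i, j))) \<le> c" if i: "i < N" for i
  proof -
    have "(\<Sum>j<N. cmod (fps_toeplitz N f $$ (i, j))) = (\<Sum>j | j \<le> i. cmod (fps_nth f (i - j)))"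
      using i by (intro sum.mono_neutral_cong_right) auto
    also have "\<dots> = (\<Sum>k | k \<le> i. cmod (fps_nth f k))"
      by (rule sum.reindex_bij_witness[of _ "\<lambda>k. i - k" "\<lambda>k. i - k"]) auto
    also have "\<dots> \<le> (\<Sum>k<N. cmod (fps_nth f k))"
      using i by (intro sum_mono2) auto
    finally show ?thesis using f by simp
  qed
  moreover have "(\<Sum>i<N. cmod (fps_toeplitz N f $$ (i, j))) \<le> c" if j: "j < N" for j
  proof -
    have "(\<Sum>i<N. cmod (fps_toeplitz N f $$ (i, j))) = (\<Sum>i | j \<le> i \<and> i < N. cmod (fps_nth f (i - j)))"
      using j by (intro sum.mono_neutral_cong_right) auto
    also have "\<dots> = (\<Sum>k | k < N - j. cmod (fps_nth f k))"
      by (rule sum.reindex_bij_witness[of _ "\<lambda>k. k + j" "\<lambda>k. k - j"]) auto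
    also have "\<dots> \<le> (\<Sum>k<N. cmod (fps_nth f k))"
      by (intro sum_mono2) auto
    finally show ?thesis using f by simp
  qed
  ultimately show ?thesis by (simp add: schur_bounded_def)
qed

text \<open>
  A product with inner dimension \<open>k\<close> is a sum of \<open>k\<close> matrices of rank at most one.
\<close>

lemma rank_mult_le:
  fixes U V :: "'a::field mat"
  assumes U: "U \<in> carrier_mat n k" and V: "V \<in> carrier_mat k nc"
  shows "vec_space.rank n (U * V) \<le> k"
proof -
  define P where "P r = Matrix.mat n nc (\<lambda>(i, j). \<Sum>b<r. U $$ (i, b) * V $$ (b, j))" for r
  have "vec_space.rank n (P r) \<le> r" for r
  proof (induction r)
    case 0
    have "P 0 = 0\<^sub>m n nc" by (rule eq_matI) (auto simp: P_def)
    then show ?case by (simp add: vec_space.rank_0I)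
  next
    case (Suc r)
    define Q where "Q = Matrix.mat n nc (\<lambda>(i, j). U $$ (i, r) * V $$ (r, j))"
    have "P (Suc r) = P r + Q" by (rule eq_matI) (auto simp: P_def Q_def)
    moreover have "vec_space.rank n Q \<le> 1"
      by (rule vec_space.rank_le_1_product_entries[where f = "\<lambda>i. U $$ (i, r)" and g = "\<lambda>j. V $$ (r, j)"])
        (auto simp: Q_def)
    moreover have "vec_space.rank n (P r + Q) \<le> vec_space.rank n (P r) + vec_space.rank n Q"
      by (rule vec_space.rank_subadditive) (auto simp: P_def Q_def)
    ultimately have "vec_space.rank n (P (Suc r)) \<le> vec_space.rank n (P r) + 1" by simp
    then show ?case using Suc by linarith
  qed
  moreover have "U * V = P k"
    using U V by (intro eq_matI) (auto simp: P_def scalar_prod_def atLeast0LessThan)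
  ultimately show ?thesis by simp
qed

section \<open>Splitting the nested matrix into small rank and bounded norm\<close>

text \<open>
  Cut the index range into blocks of length \<open>L\<close>. Below the block diagonal the nested matrix is
  constant on each block, so that part has rank at most the number of blocks, about \<open>N / L\<close>. The
  block diagonal part has rows and columns with at most \<open>L\<close> ones, so its norm is at most \<open>L\<close>.
  The nested matrix, although its norm grows like \<open>N\<close>, is thus bounded up to a small rank.
\<close>

definition block_low_rank :: "nat \<Rightarrow> nat \<Rightarrow> complex mat" where
  "block_low_rank L N = Matrix.mat N N (\<lambda>(i, j). if j div L < i div L then 1 else 0)"

definition block_diag :: "nat \<Rightarrow> nat \<Rightarrow> complex mat" where
  "block_diag L N = Matrix.mat N N (\<lambda>(i, j). if j \<le> i \<and> j div L = i div L then 1 else 0)"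

lemma ones_block_split: "fps_toeplitz N fps_ones = block_low_rank L N + block_diag L N"
proof (rule eq_matI)
  fix i j assume "i < dim_row (block_low_rank L N + block_diag L N)"
    "j < dim_col (block_low_rank L N + block_diag L N)"
  then have ij: "i < N" "j < N" by (auto simp: block_diag_def)
  have "j \<le> i \<and> j div L \<le> i div L \<or> \<not> j \<le> i \<and> i div L \<le> j div L"
    by (meson div_le_mono nat_le_linear)
  then show "fps_toeplitz N fps_ones $$ (i, j) = (block_low_rank L N + block_diag L N) $$ (i, j)"
    using ij by (auto simp: block_low_rank_def block_diag_def fps_ones_def)
qed (auto simp: block_diag_def)

lemma block_low_rank_factorization:
  obtains U V where "U \<in> carrier_mat N (N div L + 1)" "V \<in> carrier_mat (N div L + 1) N"
    "block_low_rank L N = U * V"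
proof
  let ?k = "N div L + 1"
  let ?U = "Matrix.mat N ?k (\<lambda>(i, b). if b = i div L then 1 else 0) :: complex mat"
  let ?V = "Matrix.mat ?k N (\<lambda>(b, j). if j div L < b then 1 else 0) :: complex mat"
  show "?U \<in> carrier_mat N ?k" "?V \<in> carrier_mat ?k N" by auto
  show "block_low_rank L N = ?U * ?V"
  proof (rule eq_matI)
    fix i j assume "i < dim_row (?U * ?V)" "j < dim_col (?U * ?V)"
    then have ij: "i < N" "j < N" by auto
    have "i div L < ?k" using ij by (simp add: div_le_mono less_Suc_eq_le)
    have "(?U * ?V) $$ (i, j) = (\<Sum>b<?k. (if b = i div L then 1 else 0) * (if j div L < b then 1 else 0))"
      using ij by (simp add: scalar_prod_def atLeast0LessThan del: sum.lessThan_Suc)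
    also have "\<dots> = (\<Sum>b<?k. if b = i div L then (if j div L < i div L then 1 else 0) else 0)"
      by (intro sum.cong) auto
    also have "\<dots> = block_low_rank L N $$ (i, j)"
      using ij \<open>i div L < ?k\<close> by (subst sum.delta) (auto simp: block_low_rank_def)
    finally show "block_low_rank L N $$ (i, j) = (?U * ?V) $$ (i, j)" ..
  qed (auto simp: block_low_rank_def)
qed

lemma schur_bounded_block_diag:
  assumes "0 < L"
  shows "schur_bounded (block_diag L N) (real L)"
proof -
  have card: "card {j. j < N \<and> Q j} \<le> L" if "\<And>j. Q j \<Longrightarrow> j div L = b" for Q b
  proof -
    have "j div L = b \<Longrightarrow> j \<in> {b * L..<b * L + L}" for j
      using assms by (metis atLeastLessThan_iff div_times_less_eq_dividend dividend_less_div_times add.commute)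
    then have "card {j. j < N \<and> Q j} \<le> card {b * L..<b * L + L}"
      using that by (intro card_mono) auto
    then show ?thesis by simp
  qed
  have "(\<Sum>j<N. cmod (block_diag L N $$ (i, j))) \<le> real L" if "i < N" for i
  proof -
    have "(\<Sum>j<N. cmod (block_diag L N $$ (i, j))) = (\<Sum>j | j < N \<and> (j \<le> i \<and> j div L = i div L). 1)"
      using that by (intro sum.mono_neutral_cong_right) (auto simp: block_diag_def)
    then show ?thesis using card[of "\<lambda>j. j \<le> i \<and> j div L = i div L"] by simp
  qed
  moreover have "(\<Sum>i<N. cmod (block_diag L N $$ (i, j))) \<le> real L" if "j < N" for j
  proof -
    have "(\<Sum>i<N. cmod (block_diag L N $$ (i, j))) = (\<Sum>i | i < N \<and> (j \<le> i \<and> j div L = i div L). 1)"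
      using that by (intro sum.mono_neutral_cong_right) (auto simp: block_diag_def)
    then show ?thesis using card[of "\<lambda>i. j \<le> i \<and> j div L = i div L" "j div L"] by simp
  qed
  ultimately show ?thesis by (simp add: schur_bounded_def block_diag_def)
qed

text \<open>
  With \<open>A = B + D\<close>, \<open>B\<close> of small rank and \<open>D\<close> of bounded norm, the square is
  \<open>A\<^sup>2 = B A + D B + D\<^sup>2\<close>: each of the first two terms has a factor \<open>B\<close>, and the last one
  is bounded by \<open>L\<^sup>2\<close>.
\<close>

lemma ones_sandwich_split:
  fixes W :: "complex mat"
  assumes W: "W \<in> carrier_mat N N" "schur_bounded W c" "0 \<le> c" and L: "0 < L"
  obtains R E where "R \<in> carrier_mat N N" "E \<in> carrier_mat N N"
    "W * (fps_toeplitz N fps_ones * fps_toeplitz N fps_ones) = R + E"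
    "vec_space.rank N R \<le> 2 * (N div L + 1)" "schur_bounded E (c * real L ^ 2)"
proof -
  let ?A = "fps_toeplitz N fps_ones :: complex mat"
  let ?B = "block_low_rank L N" and ?D = "block_diag L N" and ?k = "N div L + 1"
  obtain U V where UV: "U \<in> carrier_mat N ?k" "V \<in> carrier_mat ?k N" "?B = U * V"
    by (rule block_low_rank_factorization)
  have B: "?B \<in> carrier_mat N N" and D: "?D \<in> carrier_mat N N"
    by (auto simp: block_low_rank_def block_diag_def)
  let ?R = "(W * U) * (V * ?A) + (W * ?D * U) * V" and ?E = "W * (?D * ?D)"
  note [simp] = W(1) B D UV(1,2)
  have [simp]: "?B * ?A \<in> carrier_mat N N" "?D * ?B \<in> carrier_mat N N" "?D * ?D \<in> carrier_mat N N"
    by (auto intro!: mult_carrier_mat[of _ N N])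
  have VA: "V * ?A \<in> carrier_mat ?k N" using UV(2) by simp
  have WU: "W * U \<in> carrier_mat N ?k" using W(1) UV(1) by (rule mult_carrier_mat)
  have WD: "W * ?D \<in> carrier_mat N N" using W(1) D by (rule mult_carrier_mat)
  have WDU: "W * ?D * U \<in> carrier_mat N ?k" using WD UV(1) by (rule mult_carrier_mat)
  have "?A * ?A = ?B * ?A + ?D * ?A"
    by (metis B D add_mult_distrib_mat fps_toeplitz_carrier ones_block_split)
  also have "?D * ?A = ?D * ?B + ?D * ?D"
    by (metis B D mult_add_distrib_mat ones_block_split)
  finally have "W * (?A * ?A) = W * (?B * ?A + (?D * ?B + ?D * ?D))" by simp
  also have "\<dots> = W * (?B * ?A) + (W * (?D * ?B) + ?E)"
    by (simp add: mult_add_distrib_mat[of _ N N _ N])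
  also have "\<dots> = W * (?B * ?A) + W * (?D * ?B) + ?E"
    by (rule assoc_add_mat[of _ N N, symmetric]) (auto intro!: mult_carrier_mat[of _ N N])
  also have "W * (?B * ?A) = (W * U) * (V * ?A)"
  proof -
    have "?B * ?A = U * (V * ?A)"
      unfolding UV(3) by (rule assoc_mult_mat[OF UV(1,2) fps_toeplitz_carrier])
    then show ?thesis
      by (simp only: assoc_mult_mat[OF W(1) UV(1) VA])
  qed
  also have "W * (?D * ?B) = (W * ?D * U) * V"
  proof -
    have "W * (?D * ?B) = (W * ?D) * ?B" using W(1) D B by (rule assoc_mult_mat[symmetric])
    then show ?thesis
      by (simp only: UV(3) assoc_mult_mat[OF WD UV(1,2)])
  qed
  finally have eq: "W * (?A * ?A) = ?R + ?E" .
  have R1: "(W * U) * (V * ?A) \<in> carrier_mat N N" using WU VA by (rule mult_carrier_mat)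
  have R2: "(W * ?D * U) * V \<in> carrier_mat N N" using WDU UV(2) by (rule mult_carrier_mat)
  have "vec_space.rank N ?R \<le> vec_space.rank N ((W * U) * (V * ?A)) + vec_space.rank N ((W * ?D * U) * V)"
    using R1 R2 by (rule vec_space.rank_subadditive)
  also have "\<dots> \<le> ?k + ?k"
    using rank_mult_le[OF WU VA] rank_mult_le[OF WDU UV(2)] by (rule add_mono)
  finally have rank: "vec_space.rank N ?R \<le> 2 * ?k" by simp
  have "schur_bounded ?E (c * (real L * real L))"
    using W D L carrier_matD[OF D] carrier_matD[OF W(1)] by (intro schur_bounded_mult schur_bounded_block_diag) auto
  then have E: "schur_bounded ?E (c * real L ^ 2)" by (simp only: power2_eq_square)
  show ?thesis
  proof (rule that[OF _ _ eq rank E])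
    show "?R \<in> carrier_mat N N" using R1 R2 by simp
    show "?E \<in> carrier_mat N N" by (rule mult_carrier_mat[OF W(1)]) simp
  qed
qed

section \<open>Toeplitz matrices of polynomial symbols\<close>

lemma glt_algebra_const: "glt_algebra (\<lambda>N. fps_toeplitz N (fps_const c)) (\<lambda>(x, \<theta>). c)"
proof -
  have "smooth_unit_interval (\<lambda>_. c)"
    unfolding smooth_unit_interval_def
  proof (intro exI[of _ "\<lambda>k _. if k = 0 then c else 0"] conjI allI ballI)
    fix k and x :: real
    show "((\<lambda>_. if k = 0 then c else 0) has_vector_derivative (if Suc k = 0 then c else 0)) (at x within {0..1})"
      using has_vector_derivative_const[of "if k = 0 then c else 0"] by simp
  qed auto
  moreover have "mat_diag N (\<lambda>i. c) = fps_toeplitz N (fps_const c)" for N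
    by (rule eq_matI) (auto simp: mat_diag_def)
  ultimately show ?thesis using glt_algebra.diagonal[of "\<lambda>_. c"] by simp
qed

lemma toeplitz_mat_cis: "toeplitz_mat N (\<lambda>\<theta>. cis \<theta>) = fps_toeplitz N fps_X"
  using toeplitz_mat_linear_symbol[of N 0 1] by simp

lemma glt_algebra_poly:
  "glt_algebra (\<lambda>N. fps_toeplitz N (fps_of_poly p)) (\<lambda>(x, \<theta>). poly p (cis \<theta>))"
proof (induction p)
  case 0
  then show ?case using glt_algebra_const[of 0] by (simp add: case_prod_unfold)
next
  case (pCons a p)
  have "glt_algebra (\<lambda>N. fps_toeplitz N (fps_const a) +
           toeplitz_mat N (\<lambda>\<theta>. cis \<theta>) * fps_toeplitz N (fps_of_poly p))
         (\<lambda>z. (\<lambda>(x, \<theta>). a) z + (\<lambda>(x, \<theta>). cis \<theta>) z * (\<lambda>(x, \<theta>). poly p (cis \<theta>)) z)"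
    by (intro glt_algebra.add glt_algebra.mult glt_algebra_const glt_algebra.shift pCons)
  moreover have "fps_toeplitz N (fps_const a) + toeplitz_mat N (\<lambda>\<theta>. cis \<theta>) * fps_toeplitz N (fps_of_poly p)
      = fps_toeplitz N (fps_of_poly (pCons a p))" for N
    by (simp add: toeplitz_mat_cis fps_of_poly_pCons fps_toeplitz_add fps_toeplitz_mult[symmetric] mult.commute)
  ultimately show ?case by (simp add: case_prod_beta)
qed

lemma tendsto_in_measure_of_AE:
  assumes M: "finite_measure M" and f: "\<And>n. f n \<in> borel_measurable M" and g: "g \<in> borel_measurable M"
    and lim: "AE z in M. (\<lambda>n. f n z) \<longlonglongrightarrow> g z"
  shows "tendsto_in_measure M f g"
  unfolding tendsto_in_measure_def
proof (intro conjI allI impI f g)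
  fix \<epsilon> :: real assume \<epsilon>: "0 < \<epsilon>"
  define D where "D n = {z \<in> space M. \<epsilon> < dist (f n z) (g z)}" for n
  have D: "D n \<in> sets M" for n
    unfolding D_def using f g by measurable
  have "(\<lambda>n. \<integral>\<^sup>+z. indicator (D n) z \<partial>M) \<longlonglongrightarrow> (\<integral>\<^sup>+z. 0 \<partial>M)"
  proof (rule nn_integral_dominated_convergence[where w = "\<lambda>_. 1"])
    show "(\<integral>\<^sup>+z. 1 \<partial>M) < \<infinity>"
      using finite_measure.emeasure_finite[OF M, of "space M"] by (simp add: less_top)
    show "AE z in M. (\<lambda>n. indicator (D n) z :: ennreal) \<longlonglongrightarrow> 0"
      using lim
    proof eventually_elim
      case (elim z)
      have "eventually (\<lambda>n. dist (f n z) (g z) < \<epsilon>) sequentially"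
        using elim \<epsilon> by (rule tendstoD)
      then have "eventually (\<lambda>n. indicator (D n) z = (0 :: ennreal)) sequentially"
        by eventually_elim (auto simp: D_def indicator_def)
      then show ?case by (rule tendsto_eventually)
    qed
  qed (use D in \<open>auto simp: indicator_def\<close>)
  then show "(\<lambda>n. emeasure M {z \<in> space M. \<epsilon> < dist (f n z) (g z)}) \<longlonglongrightarrow> 0"
    using D by (simp add: D_def)
qed

section \<open>The nested matrix as a limit of polynomials in the shift\<close>

text \<open>
  The identity behind Cesaro summation of the geometric series. It is used both for power series,
  where it compares matrices, and for complex numbers, where it compares symbols.
\<close>

lemma weighted_geometric_sum:
  fixes x :: "'a::comm_ring_1"
  shows "(1 - x)\<^sup>2 * (\<Sum>k<K. of_nat (K - k) * x ^ k) = of_nat K * (1 - x) - (x - x ^ (K + 1))"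
proof (induction K)
  case (Suc K)
  have "(\<Sum>k<Suc K. of_nat (Suc K - k) * x ^ k) = (\<Sum>k<Suc K. of_nat (K - k) * x ^ k + x ^ k)"
    by (intro sum.cong) (auto simp: Suc_diff_le algebra_simps less_Suc_eq_le)
  also have "\<dots> = (\<Sum>k<K. of_nat (K - k) * x ^ k) + (\<Sum>k<Suc K. x ^ k)"
    unfolding sum.distrib by simp
  finally have "(1 - x)\<^sup>2 * (\<Sum>k<Suc K. of_nat (Suc K - k) * x ^ k) =
      of_nat K * (1 - x) - (x - x ^ (K + 1)) + (1 - x) * ((1 - x) * (\<Sum>k<Suc K. x ^ k))"
    using Suc by (simp only: distrib_left power2_eq_square mult.assoc)
  also have "(1 - x) * (\<Sum>k<Suc K. x ^ k) = 1 - x ^ Suc K"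
    by (rule one_diff_power_eq[symmetric])
  finally show ?case by (simp add: algebra_simps)
qed auto

text \<open>
  The Cesaro means of the geometric series. The partial sums themselves would not do: on the unit
  circle they stay bounded away from \<open>1 / (1 - z)\<close>. The weights \<open>1 - k / K\<close> gain a factor
  \<open>1 / K\<close> at the price of a second factor \<open>1 / (1 - z)\<close>.
\<close>

definition cesaro_poly :: "nat \<Rightarrow> complex poly" where
  "cesaro_poly K = Polynomial.smult (1 / of_nat K) (\<Sum>k<K. of_nat (K - k) * [:0, 1:] ^ k)"

lemma fps_ones_minus_cesaro_poly:
  assumes "0 < K"
  shows "fps_ones - fps_of_poly (cesaro_poly K) =
    fps_const (1 / of_nat K) * (fps_X - fps_X ^ (K + 1)) * (fps_ones * fps_ones)"
proof -
  let ?q = "\<Sum>k<K. of_nat (K - k) * fps_X ^ k :: complex fps"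
  let ?e = "fps_ones :: complex fps"
  have one: "?e * (1 - fps_X) = 1"
    using one_minus_X_fps_ones by (simp add: mult.commute)
  have "?e * ?e * ((1 - fps_X)\<^sup>2 * ?q) = (?e * (1 - fps_X)) * (?e * (1 - fps_X)) * ?q"
    by (simp only: power2_eq_square mult_ac)
  then have "?q = ?e * ?e * (of_nat K * (1 - fps_X) - (fps_X - fps_X ^ (K + 1)))"
    unfolding weighted_geometric_sum one by simp
  also have "\<dots> = of_nat K * ?e * (?e * (1 - fps_X)) - (fps_X - fps_X ^ (K + 1)) * (?e * ?e)"
    by (simp only: right_diff_distrib mult_ac)
  finally have q: "?q = of_nat K * ?e - (fps_X - fps_X ^ (K + 1)) * (?e * ?e)"
    unfolding one by simp
  have inv: "fps_const (1 / of_nat K) * of_nat K = (1 :: complex fps)"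
    using assms by (simp add: fps_of_nat[symmetric])
  have "fps_of_poly (cesaro_poly K) = fps_const (1 / of_nat K) * ?q"
    by (simp add: cesaro_poly_def fps_of_poly_smult fps_of_poly_sum fps_of_poly_mult fps_of_poly_power
        of_nat_poly fps_of_poly_const fps_of_nat del: of_nat_diff)
  also have "\<dots> = (fps_const (1 / of_nat K) * of_nat K) * ?e
      - fps_const (1 / of_nat K) * (fps_X - fps_X ^ (K + 1)) * (?e * ?e)"
    unfolding q by (subst right_diff_distrib) (simp only: mult.assoc)
  finally show ?thesis unfolding inv by simp
qed

lemma poly_cesaro_poly_dist:
  assumes "0 < K" "cmod z = 1" "z \<noteq> 1"
  shows "dist (poly (cesaro_poly K) z) (1 / (1 - z)) \<le> 2 / (real K * (cmod (1 - z))\<^sup>2)"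
proof -
  have "poly (cesaro_poly K) z = (\<Sum>k<K. of_nat (K - k) * z ^ k) / of_nat K"
    by (simp add: cesaro_poly_def poly_sum poly_mult of_nat_poly)
  also have "\<dots> = ((1 - z)\<^sup>2 * (\<Sum>k<K. of_nat (K - k) * z ^ k)) / (of_nat K * (1 - z)\<^sup>2)"
    using assms by simp
  also have "\<dots> = 1 / (1 - z) - (z - z ^ (K + 1)) / (of_nat K * (1 - z)\<^sup>2)"
  proof -
    have "(k * u - w) / (k * u\<^sup>2) = 1 / u - w / (k * u\<^sup>2)" if "k \<noteq> 0" "u \<noteq> 0" for k u w :: complex
      using that by (simp add: field_simps power2_eq_square)
    from this[of "of_nat K" "1 - z"] show ?thesis
      unfolding weighted_geometric_sum using assms by simp
  qed
  finally have "dist (poly (cesaro_poly K) z) (1 / (1 - z)) =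
      cmod (z - z ^ (K + 1)) / (real K * (cmod (1 - z))\<^sup>2)"
    by (simp add: dist_norm norm_divide norm_mult norm_power)
  also have "cmod (z - z ^ (K + 1)) \<le> cmod z + cmod (z ^ (K + 1))"
    by (rule norm_triangle_ineq4)
  also have "\<dots> = 2" using assms by (simp add: norm_power norm_mult)
  finally show ?thesis by (simp add: divide_right_mono)
qed

lemma borel_measurable_lebesgue_onI:
  fixes f :: "'a::euclidean_space \<Rightarrow> 'b::topological_space"
  assumes "f \<in> borel_measurable borel"
  shows "f \<in> borel_measurable (lebesgue_on S)"
  using assms by (intro measurable_restrict_space1 measurable_completion) simp

abbreviation glt_domain :: "(real \<times> real) set" where
  "glt_domain \<equiv> {0..1} \<times> {-pi..pi}"

lemma measurable_poly_cis:
  "(\<lambda>(x, \<theta>). poly p (cis \<theta>)) \<in> borel_measurable (lebesgue_on (S :: (real \<times> real) set))"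
  unfolding case_prod_beta
  by (intro borel_measurable_lebesgue_onI borel_measurable_continuous_onI continuous_intros)

lemma finite_measure_glt_domain: "finite_measure (lebesgue_on glt_domain)"
  by (intro finite_measure_lebesgue_on lmeasurable_compact compact_Times compact_Icc)

lemma glt_fps_toeplitz_poly:
  "(\<lambda>N. fps_toeplitz N (fps_of_poly p)) \<sim>\<^sub>G\<^sub>L\<^sub>T (\<lambda>(x, \<theta>). poly p (cis \<theta>))"
proof -
  let ?A = "\<lambda>N. fps_toeplitz N (fps_of_poly p)" and ?\<kappa> = "\<lambda>(x :: real, \<theta>). poly p (cis \<theta>)"
  have "acs_convergent (\<lambda>_. ?A) ?A"
    unfolding acs_convergent_def
  proof (intro exI[of _ "\<lambda>_. 0"] conjI allI impI bexI[of _ "0\<^sub>m N N" for N])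
    show "spectral_norm (0\<^sub>m N N) \<le> 0" for N
      by (rule spectral_norm_le_schur) (auto simp: schur_bounded_def)
  qed (auto simp: vec_space.rank_0I)
  moreover have "tendsto_in_measure (lebesgue_on glt_domain) (\<lambda>_. ?\<kappa>) ?\<kappa>"
    by (intro tendsto_in_measure_of_AE finite_measure_glt_domain measurable_poly_cis) simp
  ultimately show ?thesis
    unfolding glt_def matrix_seq_def using glt_algebra_poly[of p]
    by (intro conjI allI exI[of _ "\<lambda>_. ?A"] exI[of _ "\<lambda>_. ?\<kappa>"]) auto
qed

lemma schur_bounded_remainder:
  "schur_bounded (fps_toeplitz N (fps_const (1 / of_nat K) * (fps_X - fps_X ^ (K + 1)))) (2 / real K)"
proof (rule schur_bounded_fps_toeplitz)
  have nth: "fps_nth (fps_X - fps_X ^ (K + 1) :: complex fps) k =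
      (if k = 1 then 1 else 0) - (if k = K + 1 then 1 else 0)" for k
    by (simp only: fps_sub_nth fps_X_nth fps_X_power_nth)
  have "(\<Sum>k<N. cmod (fps_nth (fps_const (1 / of_nat K) * (fps_X - fps_X ^ (K + 1))) k))
     \<le> (\<Sum>k<N. (if k = 1 then 1 / real K else 0) + (if k = K + 1 then 1 / real K else 0))"
    unfolding fps_mult_left_const_nth nth by (intro sum_mono) (auto simp: norm_divide)
  also have "\<dots> \<le> 2 / real K"
    by (simp add: sum.distrib divide_right_mono)
  finally show "(\<Sum>k<N. cmod (fps_nth (fps_const (1 / of_nat K) * (fps_X - fps_X ^ (K + 1))) k)) \<le> 2 / real K" .
qed

text \<open>
  The difference of the nested matrix \<open>A\<close> and its polynomial approximation is \<open>W A\<^sup>2\<close>, where the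
  remainder factor \<open>W\<close> has norm at most \<open>2 / K\<close>.
\<close>

lemma ones_cesaro_split:
  assumes "0 < K" "0 < L"
  obtains R E where "R \<in> carrier_mat N N" "E \<in> carrier_mat N N"
    "fps_toeplitz N fps_ones = fps_toeplitz N (fps_of_poly (cesaro_poly K)) + R + E"
    "vec_space.rank N R \<le> 2 * (N div L + 1)" "schur_bounded E (2 / real K * real L ^ 2)"
proof -
  let ?A = "fps_toeplitz N fps_ones :: complex mat"
  let ?f = "fps_const (1 / of_nat K) * (fps_X - fps_X ^ (K + 1)) :: complex fps"
  have "0 \<le> 2 / real K" by simp
  from ones_sandwich_split[OF fps_toeplitz_carrier schur_bounded_remainder this \<open>0 < L\<close>]
  obtain R E where RE: "R \<in> carrier_mat N N" "E \<in> carrier_mat N N"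
      "fps_toeplitz N ?f * (?A * ?A) = R + E"
      "vec_space.rank N R \<le> 2 * (N div L + 1)" "schur_bounded E (2 / real K * real L ^ 2)"
    by blast
  have "fps_ones = fps_of_poly (cesaro_poly K) + ?f * (fps_ones * fps_ones)"
    using fps_ones_minus_cesaro_poly[OF \<open>0 < K\<close>] by (simp only: algebra_simps)
  then have "?A = fps_toeplitz N (fps_of_poly (cesaro_poly K)) + (R + E)"
    unfolding RE(3)[symmetric] fps_toeplitz_mult[symmetric] fps_toeplitz_add[symmetric] by simp
  also have "\<dots> = fps_toeplitz N (fps_of_poly (cesaro_poly K)) + R + E"
    by (rule assoc_add_mat[symmetric]) (use RE in auto)
  finally show ?thesis using that RE by blast
qed

text \<open>
  Blocks of length \<open>L = m + 1\<close> and \<open>K = L\<^sup>3\<close> make both errors of order \<open>1 / L\<close>: the rank is at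
  most \<open>2 (N / L + 1) \<le> 4 N / L\<close> once \<open>N \<ge> L\<close>, and the norm is at most
  \<open>(2 / K) L\<^sup>2 = 2 / L\<close>.
\<close>

lemma acs_convergent_ones:
  "acs_convergent (\<lambda>m N. fps_toeplitz N (fps_of_poly (cesaro_poly ((m + 1) ^ 3))))
     (\<lambda>N. fps_toeplitz N fps_ones)"
  unfolding acs_convergent_def
proof (intro exI conjI allI impI)
  show "(\<lambda>m. 4 / real (m + 1)) \<longlonglongrightarrow> 0" "(\<lambda>m. 2 / real (m + 1)) \<longlonglongrightarrow> 0"
    by real_asymp+
  fix m N :: nat
  assume N: "m + 1 \<le> N"
  define L where "L = m + 1"
  have L: "0 < L" "L \<le> N" using N by (auto simp: L_def)
  obtain R E where RE: "R \<in> carrier_mat N N" "E \<in> carrier_mat N N"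
      "fps_toeplitz N fps_ones = fps_toeplitz N (fps_of_poly (cesaro_poly (L ^ 3))) + R + E"
      "vec_space.rank N R \<le> 2 * (N div L + 1)" "schur_bounded E (2 / real (L ^ 3) * real L ^ 2)"
    by (rule ones_cesaro_split[of "L ^ 3" L N]) (use L in auto)
  have "real (N div L) * real L \<le> real N"
    by (metis div_times_less_eq_dividend of_nat_le_iff of_nat_mult)
  then have "real (N div L) \<le> real N / real L" using L by (simp add: field_simps)
  moreover have "1 \<le> real N / real L" using L by simp
  moreover have "real (vec_space.rank N R) \<le> 2 * (real (N div L) + 1)" 
    using of_nat_mono[OF RE(4), where 'a = real] by simp
  ultimately have rank: "real (vec_space.rank N R) \<le> 4 / real L * real N" by simp
  have "2 / real (L ^ 3) * real L ^ 2 = 2 / real L"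
    using L by (simp add: power2_eq_square power3_eq_cube)
  then have "spectral_norm E \<le> 2 / real L"
    using spectral_norm_le_schur[OF RE(5)] by simp
  with rank RE(1-3) show "\<exists>R\<in>carrier_mat N N. \<exists>E\<in>carrier_mat N N.
      fps_toeplitz N fps_ones = fps_toeplitz N (fps_of_poly (cesaro_poly ((m + 1) ^ 3))) + R + E \<and>
      real (vec_space.rank N R) \<le> 4 / real (m + 1) * real N \<and> spectral_norm E \<le> 2 / real (m + 1)"
    unfolding L_def by blast
qed

lemma one_minus_cis_eq_0_iff:
  assumes "\<theta> \<in> {-pi..pi}"
  shows "1 - cis \<theta> = 0 \<longleftrightarrow> \<theta> = 0"
proof
  assume "1 - cis \<theta> = 0"
  then have "cos \<theta> = 1" by (simp add: complex_eq_iff)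
  have "\<bar>\<theta>\<bar> = 0"
    by (rule cos_inj_pi) (use assms \<open>cos \<theta> = 1\<close> in auto)
  then show "\<theta> = 0" by simp
qed simp

lemma AE_snd_nonzero:
  fixes S :: "(real \<times> real) set"
  assumes "S \<in> sets lebesgue"
  shows "AE z in lebesgue_on S. snd z \<noteq> 0"
proof -
  have "negligible {z :: real \<times> real. z \<bullet> (0, 1) = 0}"
    by (rule negligible_standard_hyperplane) (simp add: Basis_prod_def)
  then have "{z :: real \<times> real. snd z = 0} \<in> null_sets lebesgue"
    by (simp add: negligible_iff_null_sets inner_prod_def)
  then have "AE z :: real \<times> real in lebesgue. snd z \<noteq> 0"
    by (auto dest: AE_not_in)
  then show ?thesis using assms by (auto simp: AE_restrict_space_iff elim: eventually_mono)
qed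

lemma glt_nest: "(\<lambda>N. fps_toeplitz N fps_ones) \<sim>\<^sub>G\<^sub>L\<^sub>T (\<lambda>(x, \<theta>). 1 / (1 - cis \<theta>))"
  unfolding glt_def
proof (intro conjI exI allI)
  show "glt_algebra (\<lambda>N. fps_toeplitz N (fps_of_poly (cesaro_poly ((m + 1) ^ 3))))
    (\<lambda>(x, \<theta>). poly (cesaro_poly ((m + 1) ^ 3)) (cis \<theta>))" for m
    by (rule glt_algebra_poly)
  show "tendsto_in_measure (lebesgue_on glt_domain)
      (\<lambda>m (x, \<theta>). poly (cesaro_poly ((m + 1) ^ 3)) (cis \<theta>)) (\<lambda>(x, \<theta>). 1 / (1 - cis \<theta>))"
  proof (rule tendsto_in_measure_of_AE[OF finite_measure_glt_domain measurable_poly_cis])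
    show "(\<lambda>(x, \<theta>). 1 / (1 - cis \<theta>)) \<in> borel_measurable (lebesgue_on glt_domain)"
      unfolding case_prod_beta cis_conv_exp
      by (intro borel_measurable_lebesgue_onI borel_measurable_divide borel_measurable_continuous_onI
          continuous_intros)
    have "AE z in lebesgue_on glt_domain. snd z \<noteq> 0"
      by (intro AE_snd_nonzero fmeasurableD lmeasurable_compact compact_Times compact_Icc)
    moreover have "AE z in lebesgue_on glt_domain. z \<in> glt_domain"
      by (rule AE_I2) simp
    ultimately show "AE z in lebesgue_on glt_domain.
        (\<lambda>m. (\<lambda>(x, \<theta>). poly (cesaro_poly ((m + 1) ^ 3)) (cis \<theta>)) z)
          \<longlonglongrightarrow> (\<lambda>(x, \<theta>). 1 / (1 - cis \<theta>)) z"
    proof eventually_elim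
      case (elim z)
      obtain x \<theta> where z: "z = (x, \<theta>)" by force
      have "cis \<theta> \<noteq> 1" using one_minus_cis_eq_0_iff[of \<theta>] elim z by auto
      then have le: "dist (poly (cesaro_poly ((m + 1) ^ 3)) (cis \<theta>)) (1 / (1 - cis \<theta>))
          \<le> 2 / (real ((m + 1) ^ 3) * (cmod (1 - cis \<theta>))\<^sup>2)" for m
        by (intro poly_cesaro_poly_dist) auto
      have "0 < cmod (1 - cis \<theta>)" using \<open>cis \<theta> \<noteq> 1\<close> by simp
      then have lim: "(\<lambda>m. 2 / (real ((m + 1) ^ 3) * (cmod (1 - cis \<theta>))\<^sup>2)) \<longlonglongrightarrow> 0"
        by real_asymp
      have "(\<lambda>m. poly (cesaro_poly ((m + 1) ^ 3)) (cis \<theta>)) \<longlonglongrightarrow> 1 / (1 - cis \<theta>)"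
        unfolding tendsto_dist_iff[of _ "1 / (1 - cis \<theta>)"]
        by (rule tendsto_sandwich[OF _ _ tendsto_const lim]) (use le in auto)
      then show ?case by (simp add: z)
    qed
  qed
qed (use acs_convergent_ones in \<open>auto simp: matrix_seq_def\<close>)

lemma mat_adjoint_carrier: "A \<in> carrier_mat n m \<Longrightarrow> mat_adjoint A \<in> carrier_mat m n"
  by (auto simp: mat_adjoint_def)

lemma mat_adjoint_index:
  "i < dim_col A \<Longrightarrow> j < dim_row A \<Longrightarrow> mat_adjoint A $$ (i, j) = conjugate (A $$ (j, i))"
  by (simp add: mat_adjoint_def mat_of_rows_index)

section \<open>Explicit singular values\<close>

text \<open>
  A pair \<open>A v = s u\<close>, \<open>A\<^sup>* u = s v\<close> exhibits \<open>s\<^sup>2\<close> as an eigenvalue of \<open>A\<^sup>* A\<close>. Since \<open>N\<close>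
  different values of \<open>s\<close> give \<open>N\<close> different roots of a polynomial of degree \<open>N\<close>, they account
  for all roots, with multiplicity one.
\<close>

lemma singular_values_eqI:
  fixes A :: "complex mat" and s :: "nat \<Rightarrow> real" and u v :: "nat \<Rightarrow> complex Matrix.vec"
  assumes A: "A \<in> carrier_mat N N"
    and s: "\<And>k. k < N \<Longrightarrow> 0 \<le> s k" "inj_on s {..<N}"
    and v: "\<And>k. k < N \<Longrightarrow> v k \<in> carrier_vec N" "\<And>k. k < N \<Longrightarrow> v k \<noteq> 0\<^sub>v N"
    and u: "\<And>k. k < N \<Longrightarrow> u k \<in> carrier_vec N"
    and Av: "\<And>k. k < N \<Longrightarrow> A *\<^sub>v v k = complex_of_real (s k) \<cdot>\<^sub>v u k"
    and Au: "\<And>k. k < N \<Longrightarrow> mat_adjoint A *\<^sub>v u k = complex_of_real (s k) \<cdot>\<^sub>v v k"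
  shows "singular_values A = image_mset s (mset_set {..<N})"
proof -
  let ?B = "mat_adjoint A * A" and ?l = "\<lambda>k. complex_of_real ((s k)\<^sup>2)"
  have adj: "mat_adjoint A \<in> carrier_mat N N" using A by (rule mat_adjoint_carrier)
  have B: "?B \<in> carrier_mat N N" using adj A by (rule mult_carrier_mat)
  have root: "poly (char_poly ?B) (?l k) = 0" if k: "k < N" for k
  proof -
    have "?B *\<^sub>v v k = mat_adjoint A *\<^sub>v (A *\<^sub>v v k)"
      using adj A v(1)[OF k] by (rule assoc_mult_mat_vec)
    also have "\<dots> = complex_of_real (s k) \<cdot>\<^sub>v (mat_adjoint A *\<^sub>v u k)"
      unfolding Av[OF k] using adj u[OF k] by (rule mult_mat_vec)
    also have "\<dots> = ?l k \<cdot>\<^sub>v v k"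
      unfolding Au[OF k] by (simp add: smult_smult_assoc power2_eq_square)
    finally have "eigenvector ?B (v k) (?l k)"
      using v[OF k] B by (auto simp: eigenvector_def)
    then show ?thesis
      unfolding eigenvalue_root_char_poly[OF B, symmetric] eigenvalue_def by blast
  qed
  have deg: "degree (char_poly ?B) = N" and nz: "char_poly ?B \<noteq> 0"
    using degree_monic_char_poly[OF B] by auto
  have inj: "inj_on ?l {..<N}"
    using s by (auto simp: inj_on_def power2_eq_iff_nonneg simp flip: of_real_power)
  have "mset_set (?l ` {..<N}) \<subseteq># proots (char_poly ?B)"
  proof (rule mset_subset_eqI)
    fix a
    show "count (mset_set (?l ` {..<N})) a \<le> count (proots (char_poly ?B)) a"
    proof (cases "a \<in> ?l ` {..<N}")
      case True
      then have "Polynomial.order a (char_poly ?B) \<noteq> 0" using root nz by (auto simp: order_root)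
      then show ?thesis using True nz by simp
    qed simp
  qed
  moreover have "size (mset_set (?l ` {..<N})) = size (proots (char_poly ?B))"
    using inj by (simp add: size_proots_complex deg card_image)
  ultimately have "proots (char_poly ?B) = mset_set (?l ` {..<N})"
    by (metis mset_subset_size nless_le subset_mset.le_imp_less_or_eq)
  also have "\<dots> = image_mset ?l (mset_set {..<N})"
    using inj by (rule image_mset_mset_set[symmetric])
  finally have "singular_values A = image_mset (\<lambda>k. sqrt ((s k)\<^sup>2)) (mset_set {..<N})"
    by (simp add: singular_values_def multiset.map_comp comp_def flip: of_real_power)
  also have "\<dots> = image_mset s (mset_set {..<N})"
    using s by (intro image_mset_cong) auto
  finally show ?thesis .
qed

text \<open>
  The singular vectors are sampled sines and cosines. The angles are chosen so that the boundary
  term at index \<open>N\<close> vanishes when the adjoint is applied: this term is \<open>sin ((N + 1/2) \<phi>)\<close> for the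
  sliding-window matrix and \<open>cos ((N + 1/2) \<phi>)\<close> for the nested matrix.
\<close>

definition sw_angle :: "nat \<Rightarrow> nat \<Rightarrow> real" where
  "sw_angle N k = 2 * (real k + 1) * pi / (2 * real N + 1)"

definition nest_angle :: "nat \<Rightarrow> nat \<Rightarrow> real" where
  "nest_angle N k = (2 * real k + 1) * pi / (2 * real N + 1)"

text \<open>
  The \<open>k\<close>-th angle lies in the \<open>k\<close>-th cell of the uniform partition of \<open>[0, \<pi>]\<close>, which makes sums
  over the angles Riemann sums.
\<close>

lemma sw_angle_bounds: "k < N \<Longrightarrow> sw_angle N k \<in> {real k * pi / real N..real (Suc k) * pi / real N}"
  and nest_angle_bounds: "k < N \<Longrightarrow> nest_angle N k \<in> {real k * pi / real N..real (Suc k) * pi / real N}"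
proof -
  assume k: "k < N"
  then have k': "real k + 1 \<le> real N" by linarith
  have *: "a * pi / b \<le> c * pi / d" if "a * d \<le> c * b" "0 < b" "0 < d" for a b c d :: real
    using that mult_right_mono[OF that(1), of pi] by (simp add: field_simps)
  show "sw_angle N k \<in> {real k * pi / real N..real (Suc k) * pi / real N}"
    unfolding sw_angle_def atLeastAtMost_iff using k k' by (intro conjI *) (auto simp: algebra_simps)
  show "nest_angle N k \<in> {real k * pi / real N..real (Suc k) * pi / real N}"
    unfolding nest_angle_def atLeastAtMost_iff using k k' by (intro conjI *) (auto simp: algebra_simps)
qed

lemma angle_strict_bounds:
  assumes "k < N"
  shows "0 < sw_angle N k" "sw_angle N k < pi" "0 < nest_angle N k" "nest_angle N k < pi"
proof -
  have "real k + 1 \<le> real N" using assms by linarith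
  then have "2 * (real k + 1) < 2 * real N + 1" "2 * real k + 1 < 2 * real N + 1" by auto
  then show "sw_angle N k < pi" "nest_angle N k < pi" "0 < sw_angle N k" "0 < nest_angle N k"
    by (auto simp: sw_angle_def nest_angle_def divide_less_eq)
qed

lemma mat_vec_index:
  assumes "A \<in> carrier_mat n m" "v \<in> carrier_vec m" "i < n"
  shows "vec_index (A *\<^sub>v v) i = (\<Sum>j<m. A $$ (i, j) * vec_index v j)"
  using assms by (auto simp: scalar_prod_def atLeast0LessThan)

lemma sin_plus_sin_half: "sin x + sin (x + \<phi>) = 2 * cos (\<phi> / 2) * sin (x + \<phi> / 2)" for x \<phi> :: real
  using sin_plus_sin[of x "x + \<phi>"] by (simp add: add_divide_distrib)

lemma singular_values_sw:
  "singular_values (cmat (sw_mat N)) = image_mset (\<lambda>k. 2 * cos (sw_angle N k / 2)) (mset_set {..<N})"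
proof -
  let ?C = "cmat (sw_mat N)"
  define v where "v k = Matrix.vec N (\<lambda>i. complex_of_real (sin ((real i + 1) * sw_angle N k)))" for k
  define u where "u k = Matrix.vec N (\<lambda>i. complex_of_real (sin ((real i + 1/2) * sw_angle N k)))" for k
  have C: "?C \<in> carrier_mat N N" by (simp add: sw_mat_def)
  show ?thesis
  proof (rule singular_values_eqI[OF C])
    show "v k \<in> carrier_vec N" "u k \<in> carrier_vec N" for k by (auto simp: u_def v_def)
  next
    fix k assume k: "k < N"
    let ?p = "sw_angle N k"
    note p = angle_strict_bounds[OF k]
    show "0 \<le> 2 * cos (?p / 2)" using p by (intro mult_nonneg_nonneg cos_ge_zero) auto
    have "vec_index (v k) 0 \<noteq> 0"
      using k p sin_gt_zero[of ?p] by (simp add: v_def)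
    then show "v k \<noteq> 0\<^sub>v N" using k by auto
    show "?C *\<^sub>v v k = complex_of_real (2 * cos (?p / 2)) \<cdot>\<^sub>v u k"
    proof (rule eq_vecI)
      fix i assume "i < dim_vec (complex_of_real (2 * cos (?p / 2)) \<cdot>\<^sub>v u k)"
      then have i: "i < N" by (simp add: u_def)
      have "vec_index (?C *\<^sub>v v k) i = (\<Sum>j<N. ?C $$ (i, j) * vec_index (v k) j)"
        using C _ i by (rule mat_vec_index) (simp add: v_def)
      also have "\<dots> = (\<Sum>j | j = i \<or> j + 1 = i. complex_of_real (sin ((real j + 1) * ?p)))"
        using i by (intro sum.mono_neutral_cong_right) (auto simp: sw_mat_def v_def)
      also have "\<dots> = complex_of_real (sin (real i * ?p) + sin (real i * ?p + ?p))"
      proof (cases i)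
        case (Suc l)
        then have "{j. j = i \<or> j + 1 = i} = {l, Suc l}" by auto
        then show ?thesis using Suc by (simp add: algebra_simps)
      qed simp
      also have "\<dots> = vec_index (complex_of_real (2 * cos (?p / 2)) \<cdot>\<^sub>v u k) i"
        unfolding sin_plus_sin_half using i by (simp add: u_def algebra_simps)
      finally show "vec_index (?C *\<^sub>v v k) i = vec_index (complex_of_real (2 * cos (?p / 2)) \<cdot>\<^sub>v u k) i" .
    qed (simp add: u_def sw_mat_def)
    have end0: "sin ((real N + 1/2) * ?p) = 0"
    proof -
      have "(real N + 1/2) * ?p = real (Suc k) * pi"
        by (simp add: sw_angle_def field_simps)
      then show ?thesis using sin_npi[of "Suc k"] by (simp only: mult.commute)
    qed
    show "mat_adjoint ?C *\<^sub>v u k = complex_of_real (2 * cos (?p / 2)) \<cdot>\<^sub>v v k"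
    proof (rule eq_vecI)
      fix i assume "i < dim_vec (complex_of_real (2 * cos (?p / 2)) \<cdot>\<^sub>v v k)"
      then have i: "i < N" by (simp add: v_def)
      have "vec_index (mat_adjoint ?C *\<^sub>v u k) i = (\<Sum>j<N. mat_adjoint ?C $$ (i, j) * vec_index (u k) j)"
        using mat_adjoint_carrier[OF C] _ i by (rule mat_vec_index) (simp add: u_def)
      also have "\<dots> = (\<Sum>j<N. if j = i \<or> j = i + 1 then complex_of_real (sin ((real j + 1/2) * ?p)) else 0)"
        using i by (intro sum.cong) (auto simp: mat_adjoint_index sw_mat_def u_def)
      \<comment> \<open>Adding the vanishing term at \<open>j = N\<close> treats the last row like the others.\<close>
      also have "\<dots> = (\<Sum>j<Suc N. if j = i \<or> j = i + 1 then complex_of_real (sin ((real j + 1/2) * ?p)) else 0)"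
        using end0 by simp
      also have "\<dots> = (\<Sum>j\<in>{i, Suc i}. complex_of_real (sin ((real j + 1/2) * ?p)))"
        using i by (intro sum.mono_neutral_cong_right) auto
      also have "\<dots> = complex_of_real (sin ((real i + 1/2) * ?p) + sin ((real i + 1/2) * ?p + ?p))"
        by (simp add: algebra_simps)
      also have "\<dots> = vec_index (complex_of_real (2 * cos (?p / 2)) \<cdot>\<^sub>v v k) i"
        unfolding sin_plus_sin_half using i by (simp add: v_def algebra_simps)
      finally show "vec_index (mat_adjoint ?C *\<^sub>v u k) i = vec_index (complex_of_real (2 * cos (?p / 2)) \<cdot>\<^sub>v v k) i" .
    qed (use C in \<open>simp add: v_def sw_mat_def mat_adjoint_def\<close>)
  next
    show "inj_on (\<lambda>k. 2 * cos (sw_angle N k / 2)) {..<N}"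
    proof (rule inj_onI)
      fix k l assume kl: "k \<in> {..<N}" "l \<in> {..<N}" "2 * cos (sw_angle N k / 2) = 2 * cos (sw_angle N l / 2)"
      have "sw_angle N k / 2 = sw_angle N l / 2"
        by (rule cos_inj_pi) (use kl angle_strict_bounds[of k N] angle_strict_bounds[of l N] in auto)
      then show "k = l" by (simp add: sw_angle_def)
    qed
  qed
qed

lemma sin_minus_sin_half: "sin (x + \<phi>) - sin x = 2 * sin (\<phi> / 2) * cos (x + \<phi> / 2)" for x \<phi> :: real
  using sin_diff_sin[of "x + \<phi>" x] by (simp add: add_divide_distrib)

lemma cos_minus_cos_half: "cos x - cos (x + \<phi>) = 2 * sin (\<phi> / 2) * sin (x + \<phi> / 2)" for x \<phi> :: real
  using cos_diff_cos[of x "x + \<phi>"] by (simp add: add_divide_distrib)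

lemma sum_cos_telescope:
  fixes \<phi> :: real
  shows "2 * sin (\<phi> / 2) * (\<Sum>j<n. cos ((real j + 1/2) * \<phi>)) = sin (real n * \<phi>)"
proof (induction n)
  case (Suc n)
  have "2 * sin (\<phi> / 2) * cos ((real n + 1/2) * \<phi>) = sin (real (Suc n) * \<phi>) - sin (real n * \<phi>)"
    using sin_minus_sin_half[of "real n * \<phi>" \<phi>] by (simp add: distrib_right add.commute)
  then show ?case using Suc by (simp add: distrib_left)
qed simp

lemma sum_sin_telescope:
  fixes \<phi> :: real
  assumes "i \<le> n"
  shows "2 * sin (\<phi> / 2) * (\<Sum>j=i..<n. sin ((real j + 1) * \<phi>)) =
    cos ((real i + 1/2) * \<phi>) - cos ((real n + 1/2) * \<phi>)"
  using assms
proof (induction n rule: dec_induct)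
  case (step n)
  have "(real (Suc n) + 1/2) * \<phi> = (real n + 1/2) * \<phi> + \<phi>"
    and "(real n + 1) * \<phi> = (real n + 1/2) * \<phi> + \<phi> / 2"
    by (auto simp: algebra_simps)
  then have "2 * sin (\<phi> / 2) * sin ((real n + 1) * \<phi>) =
      cos ((real n + 1/2) * \<phi>) - cos ((real (Suc n) + 1/2) * \<phi>)"
    by (simp only: cos_minus_cos_half)
  then show ?case using step by (simp add: distrib_left)
qed simp

lemma singular_values_nest:
  "singular_values (cmat (nest_mat N)) =
     image_mset (\<lambda>k. 1 / (2 * sin (nest_angle N k / 2))) (mset_set {..<N})"
proof -
  let ?C = "cmat (nest_mat N)"
  define v where "v k = Matrix.vec N (\<lambda>i. complex_of_real (cos ((real i + 1/2) * nest_angle N k)))" for k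
  define u where "u k = Matrix.vec N (\<lambda>i. complex_of_real (sin ((real i + 1) * nest_angle N k)))" for k
  have C: "?C \<in> carrier_mat N N" by (simp add: nest_mat_def)
  show ?thesis
  proof (rule singular_values_eqI[OF C])
    show "v k \<in> carrier_vec N" "u k \<in> carrier_vec N" for k by (auto simp: u_def v_def)
  next
    fix k assume k: "k < N"
    let ?p = "nest_angle N k"
    note p = angle_strict_bounds[OF k]
    have sin_pos: "0 < sin (?p / 2)" using p by (intro sin_gt_zero) auto
    then show "0 \<le> 1 / (2 * sin (?p / 2))" by simp
    have "vec_index (v k) 0 \<noteq> 0"
      using k p cos_gt_zero[of "?p / 2"] by (simp add: v_def)
    then show "v k \<noteq> 0\<^sub>v N" using k by auto
    show "?C *\<^sub>v v k = complex_of_real (1 / (2 * sin (?p / 2))) \<cdot>\<^sub>v u k"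
    proof (rule eq_vecI)
      fix i assume "i < dim_vec (complex_of_real (1 / (2 * sin (?p / 2))) \<cdot>\<^sub>v u k)"
      then have i: "i < N" by (simp add: u_def)
      have "vec_index (?C *\<^sub>v v k) i = (\<Sum>j<N. ?C $$ (i, j) * vec_index (v k) j)"
        using C _ i by (rule mat_vec_index) (simp add: v_def)
      also have "\<dots> = (\<Sum>j<Suc i. complex_of_real (cos ((real j + 1/2) * ?p)))"
        using i by (intro sum.mono_neutral_cong_right) (auto simp: nest_mat_def v_def)
      also have "\<dots> = complex_of_real (\<Sum>j<Suc i. cos ((real j + 1/2) * ?p))"
        by (simp only: of_real_sum)
      also have "(\<Sum>j<Suc i. cos ((real j + 1/2) * ?p)) = 1 / (2 * sin (?p / 2)) * sin (real (Suc i) * ?p)"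
        using sum_cos_telescope[of ?p "Suc i"] sin_pos by (simp add: field_simps del: sum.lessThan_Suc)
      also have "complex_of_real \<dots> = vec_index (complex_of_real (1 / (2 * sin (?p / 2))) \<cdot>\<^sub>v u k) i"
        using i by (simp add: u_def add.commute)
      finally show "vec_index (?C *\<^sub>v v k) i = vec_index (complex_of_real (1 / (2 * sin (?p / 2))) \<cdot>\<^sub>v u k) i" .
    qed (simp add: u_def nest_mat_def)
    have end0: "cos ((real N + 1/2) * ?p) = 0"
    proof -
      have "(real N + 1/2) * ?p = real k * pi + pi / 2"
        by (simp add: nest_angle_def field_simps)
      then show ?thesis by (simp add: cos_add)
    qed
    show "mat_adjoint ?C *\<^sub>v u k = complex_of_real (1 / (2 * sin (?p / 2))) \<cdot>\<^sub>v v k"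
    proof (rule eq_vecI)
      fix i assume "i < dim_vec (complex_of_real (1 / (2 * sin (?p / 2))) \<cdot>\<^sub>v v k)"
      then have i: "i < N" by (simp add: v_def)
      have "vec_index (mat_adjoint ?C *\<^sub>v u k) i = (\<Sum>j<N. mat_adjoint ?C $$ (i, j) * vec_index (u k) j)"
        using mat_adjoint_carrier[OF C] _ i by (rule mat_vec_index) (simp add: u_def)
      also have "\<dots> = (\<Sum>j=i..<N. complex_of_real (sin ((real j + 1) * ?p)))"
        using i by (intro sum.mono_neutral_cong_right) (auto simp: mat_adjoint_index nest_mat_def u_def)
      also have "\<dots> = complex_of_real (\<Sum>j=i..<N. sin ((real j + 1) * ?p))"
        by (simp only: of_real_sum)
      also have "(\<Sum>j=i..<N. sin ((real j + 1) * ?p)) = 1 / (2 * sin (?p / 2)) * cos ((real i + 1/2) * ?p)"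
        using sum_sin_telescope[of i N ?p] sin_pos i end0 by (simp add: field_simps)
      also have "complex_of_real \<dots> = vec_index (complex_of_real (1 / (2 * sin (?p / 2))) \<cdot>\<^sub>v v k) i"
        using i by (simp add: v_def)
      finally show "vec_index (mat_adjoint ?C *\<^sub>v u k) i = vec_index (complex_of_real (1 / (2 * sin (?p / 2))) \<cdot>\<^sub>v v k) i" .
    qed (use C in \<open>simp add: v_def nest_mat_def mat_adjoint_def\<close>)
  next
    show "inj_on (\<lambda>k. 1 / (2 * sin (nest_angle N k / 2))) {..<N}"
    proof (rule inj_onI)
      fix k l assume kl: "k \<in> {..<N}" "l \<in> {..<N}"
        "1 / (2 * sin (nest_angle N k / 2)) = 1 / (2 * sin (nest_angle N l / 2))"
      have "nest_angle N k / 2 = nest_angle N l / 2"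
        by (rule sin_inj_pi) (use kl angle_strict_bounds[of k N] angle_strict_bounds[of l N] in auto)
      then show "k = l" by (simp add: nest_angle_def)
    qed
  qed
qed

section \<open>Singular value distributions as limits of Riemann sums\<close>

lemma cell_integral_bound:
  fixes G :: "real \<Rightarrow> complex"
  assumes G: "G integrable_on {a..b}" and ab: "a \<le> b"
    and close: "\<And>x. x \<in> {a..b} \<Longrightarrow> cmod (G x - c) \<le> e" and e: "0 \<le> e"
  shows "cmod (integral {a..b} G - of_real (b - a) * c) \<le> e * (b - a)"
proof -
  have "((\<lambda>x. G x - c) has_integral (integral {a..b} G - (b - a) *\<^sub>R c)) {a..b}"
    using has_integral_diff[OF integrable_integral[OF G] has_integral_const_real[of c a b]] ab by simp
  then have "cmod (integral {a..b} G - (b - a) *\<^sub>R c) \<le> e * measure lborel {a..b}"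
    by (rule has_integral_bound_real[OF e finite.emptyI]) (use close in auto)
  then show ?thesis using ab by (simp add: scaleR_conv_of_real)
qed

lemma riemann_sum_tendsto:
  fixes G :: "real \<Rightarrow> complex" and t :: "nat \<Rightarrow> nat \<Rightarrow> real"
  assumes G: "continuous_on {0..b} G" and b: "0 < b"
    and t: "\<And>N k. k < N \<Longrightarrow> t N k \<in> {real k * b / real N..real (Suc k) * b / real N}"
  shows "(\<lambda>N. 1 / of_nat N * (\<Sum>k<N. G (t N k))) \<longlonglongrightarrow> of_real (1 / b) * integral {0..b} G"
proof (rule LIMSEQ_I)
  fix e :: real assume e: "0 < e"
  have int: "G integrable_on {c..d}" if "0 \<le> c" "d \<le> b" for c d
    using that by (intro integrable_continuous_real continuous_on_subset[OF G]) auto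
  have "uniformly_continuous_on {0..b} G"
    using G by (intro compact_uniformly_continuous) auto
  then obtain d where d: "0 < d"
      and close: "\<And>x y. x \<in> {0..b} \<Longrightarrow> y \<in> {0..b} \<Longrightarrow> dist y x < d \<Longrightarrow> dist (G y) (G x) < e / 2"
    unfolding uniformly_continuous_on_def by (metis e half_gt_zero)
  obtain N0 where N0: "b / d < real N0" using reals_Archimedean2 by blast
  show "\<exists>no. \<forall>N\<ge>no. norm (1 / of_nat N * (\<Sum>k<N. G (t N k)) - of_real (1 / b) * integral {0..b} G) < e"
  proof (intro exI allI impI)
    fix N assume "max 1 N0 \<le> N"
    then have N: "0 < N" "b / d < real N" using N0 by auto
    define x where "x k = real k * b / real N" for k
    have h: "b / real N < d" using N d by (simp add: field_simps)
    have x_Suc: "x (Suc k) = x k + b / real N" for k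
      by (simp add: x_def add_divide_distrib distrib_right)
    have x_bound: "0 \<le> x k" "k \<le> N \<Longrightarrow> x k \<le> b" for k
      using b N by (auto simp: x_def divide_le_eq mult.commute[of b] intro: mult_right_mono)
    have split: "integral {0..b} G = (\<Sum>k<N. integral {x k..x (Suc k)} G)"
    proof -
      have "n \<le> N \<Longrightarrow> integral {0..x n} G = (\<Sum>k<n. integral {x k..x (Suc k)} G)" for n
      proof (induction n)
        case (Suc n)
        have "integral {0..x n} G + integral {x n..x (Suc n)} G = integral {0..x (Suc n)} G"
          using Suc.prems b x_bound(1)[of n] x_bound(2)[of "Suc n"] N
          by (intro Henstock_Kurzweil_Integration.integral_combine int) (auto simp: x_Suc)
        then show ?case using Suc by simp
      qed (simp add: x_def)
      from this[of N] show ?thesis using N by (simp add: x_def)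
    qed
    have cell: "cmod (integral {x k..x (Suc k)} G - of_real (b / real N) * G (t N k)) \<le> e / 2 * (b / real N)"
      if k: "k < N" for k
    proof -
      have tk: "t N k \<in> {x k..x (Suc k)}" using t[OF k] by (simp add: x_def)
      have "cmod (G y - G (t N k)) \<le> e / 2" if y: "y \<in> {x k..x (Suc k)}" for y
      proof -
        have "y \<in> {0..b}" "t N k \<in> {0..b}"
          using y tk k x_bound(1)[of k] x_bound(2)[of "Suc k"] by auto
        moreover have "dist y (t N k) < d"
          using y tk h by (auto simp: dist_real_def x_Suc)
        ultimately show ?thesis using close[of "t N k" y] by (simp add: dist_norm)
      qed
      then have "cmod (integral {x k..x (Suc k)} G - of_real (x (Suc k) - x k) * G (t N k)) \<le>
          e / 2 * (x (Suc k) - x k)"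
        using k e b x_bound(1)[of k] x_bound(2)[of "Suc k"]
        by (intro cell_integral_bound int) (auto simp: x_Suc)
      then show ?thesis by (simp add: x_Suc)
    qed
    have "cmod (integral {0..b} G - of_real (b / real N) * (\<Sum>k<N. G (t N k))) =
        cmod (\<Sum>k<N. integral {x k..x (Suc k)} G - of_real (b / real N) * G (t N k))"
      unfolding split by (simp only: sum_subtractf sum_distrib_left)
    also have "\<dots> \<le> (\<Sum>k<N. e / 2 * (b / real N))"
      using cell by (intro sum_norm_le) auto
    also have "\<dots> = e / 2 * b" using N by simp
    finally have bound: "cmod (integral {0..b} G - of_real (b / real N) * (\<Sum>k<N. G (t N k))) \<le> e / 2 * b" .
    have "1 / of_nat N * (\<Sum>k<N. G (t N k)) - of_real (1 / b) * integral {0..b} G =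
        - of_real (1 / b) * (integral {0..b} G - of_real (b / real N) * (\<Sum>k<N. G (t N k)))"
      using b by (simp add: algebra_simps)
    then have "norm (1 / of_nat N * (\<Sum>k<N. G (t N k)) - of_real (1 / b) * integral {0..b} G) =
        1 / b * cmod (integral {0..b} G - of_real (b / real N) * (\<Sum>k<N. G (t N k)))"
      using b by (simp only: norm_mult norm_minus_cancel norm_of_real) simp
    also have "\<dots> \<le> 1 / b * (e / 2 * b)"
      using bound b by (intro mult_left_mono) auto
    also have "\<dots> < e" using b e by simp
    finally show "norm (1 / of_nat N * (\<Sum>k<N. G (t N k)) - of_real (1 / b) * integral {0..b} G) < e" .
  qed
qed

lemma even_set_integral:
  fixes G :: "real \<Rightarrow> complex"
  assumes G: "continuous_on UNIV G" and even: "\<And>x. G (- x) = G x" and b: "0 \<le> b"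
  shows "(LINT x:{-b..b}|lebesgue. G x) = 2 * integral {0..b} G"
proof -
  have "set_integrable lborel {-b..b} G"
    unfolding set_integrable_def
    by (intro borel_integrable_compact continuous_on_subset[OF G]) auto
  then have "set_integrable lebesgue {-b..b} G"
    unfolding set_integrable_def by (subst integrable_completion) (auto simp: borel_measurable_integrable)
  then have "(LINT x:{-b..b}|lebesgue. G x) = integral {-b..b} G"
    by (rule set_lebesgue_integral_eq_integral)
  also have "\<dots> = integral {-b..0} G + integral {0..b} G"
    using b by (intro Henstock_Kurzweil_Integration.integral_combine[symmetric]
        integrable_continuous_real continuous_on_subset[OF G]) auto
  also have "integral {-b..0} G = integral {0..b} G"
    using Henstock_Kurzweil_Integration.integral_reflect_real[of b 0 G] by (simp add: even)
  finally show ?thesis by simp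
qed

lemma AE_lebesgue_nonzero: "AE x :: real in lebesgue. x \<noteq> 0"
  using negligible_sing[of "0 :: real"] AE_not_in[of "{0 :: real}" lebesgue]
  by (simp add: negligible_iff_null_sets)

text \<open>
  If the singular values are samples \<open>g (t N k)\<close> of a function at points equidistributed in
  \<open>[0, \<pi>]\<close>, and \<open>\<bar>f\<bar>\<close> is an even extension of \<open>g\<close>, then the symbol is \<open>f\<close>. Continuity is
  asked of the compositions with test functions instead of \<open>f\<close> itself, which leaves room for the
  pole of the nested symbol. The point \<open>0\<close> is left out because the value of the symbol there is a convention
  for division by zero.
\<close>

lemma sv_distributedI:
  fixes g :: "real \<Rightarrow> real" and f :: "real \<Rightarrow> complex"
  assumes A: "matrix_seq A" and f: "f \<in> borel_measurable (lebesgue_on {-pi..pi})"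
    and sv: "\<And>N. singular_values (A N) = image_mset (\<lambda>k. g (t N k)) (mset_set {..<N})"
    and t: "\<And>N k. k < N \<Longrightarrow> t N k \<in> {real k * pi / real N..real (Suc k) * pi / real N}"
    and t': "\<And>N k. k < N \<Longrightarrow> 0 < t N k \<and> t N k < pi"
    and ext: "\<And>F :: real \<Rightarrow> complex. continuous_on UNIV F \<Longrightarrow> compact (closure {x. F x \<noteq> 0}) \<Longrightarrow>
      \<exists>G. continuous_on UNIV G \<and> (\<forall>\<theta>. G (- \<theta>) = G \<theta>) \<and> (\<forall>\<theta>\<in>{0<..<pi}. G \<theta> = F (g \<theta>)) \<and>
        (\<forall>\<theta>\<in>{-pi..pi} - {0}. G \<theta> = F (cmod (f \<theta>)))"
  shows "A \<sim>\<^sub>\<sigma> f"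
  unfolding sv_distributed_def
proof (intro conjI allI impI A f)
  fix F :: "real \<Rightarrow> complex"
  assume F: "continuous_on UNIV F \<and> compact (closure {x. F x \<noteq> 0})"
  from ext[OF this[THEN conjunct1] this[THEN conjunct2]]
  obtain G where G: "continuous_on UNIV G" "\<forall>\<theta>. G (- \<theta>) = G \<theta>"
    "\<forall>\<theta>\<in>{0<..<pi}. G \<theta> = F (g \<theta>)" "\<forall>\<theta>\<in>{-pi..pi} - {0}. G \<theta> = F (cmod (f \<theta>))"
    by (elim exE conjE)
  have sum: "(\<Sum>\<sigma>\<in>#singular_values (A N). F \<sigma>) = (\<Sum>k<N. G (t N k))" for N
  proof -
    have "(\<Sum>\<sigma>\<in>#singular_values (A N). F \<sigma>) = (\<Sum>k<N. F (g (t N k)))"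
      by (simp add: sv multiset.map_comp comp_def sum_unfold_sum_mset)
    also have "\<dots> = (\<Sum>k<N. G (t N k))"
      by (intro sum.cong refl) (use t' G(3) in simp)
    finally show ?thesis .
  qed
  have "(LINT \<theta>:{-pi..pi}|lebesgue. F (cmod (f \<theta>))) = (LINT \<theta>:{-pi..pi}|lebesgue. G \<theta>)"
    unfolding set_lebesgue_integral_def
  proof (rule integral_cong_AE)
    show "AE x in lebesgue. indicator {-pi..pi} x *\<^sub>R F (cmod (f x)) = indicator {-pi..pi} x *\<^sub>R G x"
      using AE_lebesgue_nonzero
    proof eventually_elim
      case (elim x)
      then show ?case using G(4) by (cases "x \<in> {-pi..pi}") auto
    qed
    have "G \<in> borel_measurable lebesgue"
      using borel_measurable_continuous_onI[OF G(1)] by (intro measurable_completion) simp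
    then show "(\<lambda>x. indicator {-pi..pi} x *\<^sub>R G x) \<in> borel_measurable lebesgue"
      by (intro borel_measurable_scaleR borel_measurable_indicator) auto
    have "F \<in> borel_measurable borel"
      using F by (intro borel_measurable_continuous_onI) auto
    with measurable_compose[OF f borel_measurable_norm]
    have "(\<lambda>x. F (cmod (f x))) \<in> borel_measurable (lebesgue_on {-pi..pi})"
      by (rule measurable_compose)
    then show "(\<lambda>x. indicator {-pi..pi} x *\<^sub>R F (cmod (f x))) \<in> borel_measurable lebesgue"
      by (subst (asm) borel_measurable_restrict_space_iff) auto
  qed
  also have "\<dots> = 2 * integral {0..pi} G"
    using G(1) G(2)[rule_format] by (rule even_set_integral) simp
  finally have "complex_of_real (1 / (2 * pi)) * (LINT \<theta>:{-pi..pi}|lebesgue. F (cmod (f \<theta>))) =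
      of_real (1 / pi) * integral {0..pi} G" by simp
  moreover have "(\<lambda>N. 1 / of_nat N * (\<Sum>k<N. G (t N k))) \<longlonglongrightarrow> of_real (1 / pi) * integral {0..pi} G"
    using continuous_on_subset[OF G(1)] t by (intro riemann_sum_tendsto) auto
  ultimately show "(\<lambda>N. 1 / of_nat N * (\<Sum>\<sigma>\<in>#singular_values (A N). F \<sigma>))
      \<longlonglongrightarrow> complex_of_real (1 / (2 * pi)) * (LINT \<theta>:{-pi..pi}|lebesgue. F (cmod (f \<theta>)))"
    unfolding sum by simp
qed

text \<open>
  A compactly supported test function vanishes near infinity, so its composition with the inverse
  extends continuously by \<open>0\<close>. This removes the singularity of \<open>1 / (2 \<bar>sin (\<theta> / 2)\<bar>)\<close> at the
  origin.
\<close>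

lemma continuous_on_inverse_of_compact_support:
  fixes F :: "real \<Rightarrow> complex"
  assumes F: "continuous_on UNIV F" and supp: "compact (closure {x. F x \<noteq> 0})"
  shows "continuous_on UNIV (\<lambda>s. if s = 0 then 0 else F (1 / s))"
proof -
  obtain r where r: "0 < r" "\<And>x. F x \<noteq> 0 \<Longrightarrow> \<bar>x\<bar> \<le> r"
    using compact_imp_bounded[OF supp] closure_subset[of "{x. F x \<noteq> 0}"]
    unfolding bounded_pos by (auto simp: subset_iff)
  let ?H = "\<lambda>s. if s = 0 then 0 else F (1 / s)"
  have "continuous_on ({-1/r<..<1/r} \<union> - {0}) ?H"
  proof (rule continuous_on_open_Un)
    have "?H s = 0" if "s \<in> {-1/r<..<1/r}" for s
    proof (cases "s = 0")
      case False
      have "\<bar>s\<bar> < 1 / r" using that by auto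
      then have "r < \<bar>1 / s\<bar>" using False r(1) by (simp add: field_simps)
      then have "F (1 / s) = 0" using r(2)[of "1 / s"] by (meson not_le)
      then show ?thesis by simp
    qed simp
    then show "continuous_on {-1/r<..<1/r} ?H"
      by (intro continuous_on_eq[OF continuous_on_const[of _ 0]]) auto
    have "continuous_on (- {0}) (\<lambda>s. F (1 / s))"
      by (intro continuous_on_compose2[OF F] continuous_intros) auto
    then show "continuous_on (- {0}) ?H" by (rule continuous_on_eq) auto
  qed auto
  moreover have "{-1/r<..<1/r} \<union> - {0} = UNIV" using r(1) by auto
  ultimately show ?thesis by simp
qed

lemma cmod_one_plus_cis: "cmod (1 + cis \<theta>) = 2 * \<bar>cos (\<theta> / 2)\<bar>"
proof (rule power2_eq_imp_eq)
  have "(cmod (1 + cis \<theta>))\<^sup>2 = 1 + 2 * cos \<theta> + ((sin \<theta>)\<^sup>2 + (cos \<theta>)\<^sup>2)"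
    unfolding cmod_power2 by (simp add: power2_sum)
  also have "\<dots> = 2 + 2 * cos (2 * (\<theta> / 2))"
    unfolding sin_cos_squared_add by simp
  also have "\<dots> = (2 * \<bar>cos (\<theta> / 2)\<bar>)\<^sup>2"
    unfolding cos_double_cos by (simp add: power_mult_distrib)
  finally show "(cmod (1 + cis \<theta>))\<^sup>2 = (2 * \<bar>cos (\<theta> / 2)\<bar>)\<^sup>2" .
qed auto

lemma cmod_one_minus_cis: "cmod (1 - cis \<theta>) = 2 * \<bar>sin (\<theta> / 2)\<bar>"
proof (rule power2_eq_imp_eq)
  have "(cmod (1 - cis \<theta>))\<^sup>2 = 1 - 2 * cos \<theta> + ((sin \<theta>)\<^sup>2 + (cos \<theta>)\<^sup>2)"
    unfolding cmod_power2 by (simp add: power2_diff)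
  also have "\<dots> = 2 - 2 * cos (2 * (\<theta> / 2))"
    unfolding sin_cos_squared_add by simp
  also have "\<dots> = (2 * \<bar>sin (\<theta> / 2)\<bar>)\<^sup>2"
    unfolding cos_double_sin by (simp add: power_mult_distrib)
  finally show "(cmod (1 - cis \<theta>))\<^sup>2 = (2 * \<bar>sin (\<theta> / 2)\<bar>)\<^sup>2" .
qed auto

lemma sw_distributed: "(\<lambda>N. cmat (sw_mat N)) \<sim>\<^sub>\<sigma> (\<lambda>\<theta>. complex_of_real (2 * \<bar>cos (\<theta> / 2)\<bar>))"
proof (rule sv_distributedI[where g = "\<lambda>\<theta>. 2 * cos (\<theta> / 2)" and t = sw_angle])
  show "matrix_seq (\<lambda>N. cmat (sw_mat N))" by (simp add: matrix_seq_def sw_mat_def)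
  show "(\<lambda>\<theta>. complex_of_real (2 * \<bar>cos (\<theta> / 2)\<bar>)) \<in> borel_measurable (lebesgue_on {-pi..pi})"
    by (intro borel_measurable_lebesgue_onI borel_measurable_continuous_onI continuous_intros) auto
  fix F :: "real \<Rightarrow> complex" assume F: "continuous_on UNIV F"
  let ?G = "\<lambda>\<theta>. F (2 * \<bar>cos (\<theta> / 2)\<bar>)"
  have "continuous_on UNIV ?G"
    by (intro continuous_on_compose2[OF F] continuous_intros) auto
  moreover have "?G \<theta> = F (2 * cos (\<theta> / 2))" if "\<theta> \<in> {0<..<pi}" for \<theta>
    using that cos_gt_zero[of "\<theta> / 2"] by simp
  ultimately show "\<exists>G. continuous_on UNIV G \<and> (\<forall>\<theta>. G (- \<theta>) = G \<theta>) \<and>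
      (\<forall>\<theta>\<in>{0<..<pi}. G \<theta> = F (2 * cos (\<theta> / 2))) \<and>
      (\<forall>\<theta>\<in>{-pi..pi} - {0}. G \<theta> = F (cmod (complex_of_real (2 * \<bar>cos (\<theta> / 2)\<bar>))))"
    by (intro exI[of _ ?G]) (auto simp: norm_mult)
qed (auto simp: singular_values_sw sw_angle_bounds[simplified] angle_strict_bounds)

lemma nest_distributed:
  "(\<lambda>N. cmat (nest_mat N)) \<sim>\<^sub>\<sigma> (\<lambda>\<theta>. complex_of_real (1 / (2 * \<bar>sin (\<theta> / 2)\<bar>)))"
proof (rule sv_distributedI[where g = "\<lambda>\<theta>. 1 / (2 * sin (\<theta> / 2))" and t = nest_angle])
  show "matrix_seq (\<lambda>N. cmat (nest_mat N))" by (simp add: matrix_seq_def nest_mat_def)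
  show "(\<lambda>\<theta>. complex_of_real (1 / (2 * \<bar>sin (\<theta> / 2)\<bar>))) \<in> borel_measurable (lebesgue_on {-pi..pi})"
    unfolding of_real_divide
    by (intro borel_measurable_lebesgue_onI borel_measurable_divide borel_measurable_continuous_onI
        continuous_intros) simp
  fix F :: "real \<Rightarrow> complex" assume F: "continuous_on UNIV F" "compact (closure {x. F x \<noteq> 0})"
  define H where "H s = (if s = 0 then 0 else F (1 / s))" for s
  let ?G = "\<lambda>\<theta>. H (2 * \<bar>sin (\<theta> / 2)\<bar>)"
  have "continuous_on UNIV H"
    unfolding H_def using F by (rule continuous_on_inverse_of_compact_support)
  then have "continuous_on UNIV ?G"
    by (rule continuous_on_compose2) (auto intro!: continuous_intros)
  moreover have "?G \<theta> = F (1 / (2 * sin (\<theta> / 2)))" if "\<theta> \<in> {0<..<pi}" for \<theta>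
    using that sin_gt_zero[of "\<theta> / 2"] by (simp add: H_def)
  moreover have "?G \<theta> = F (cmod (complex_of_real (1 / (2 * \<bar>sin (\<theta> / 2)\<bar>))))"
    if "\<theta> \<in> {-pi..pi} - {0}" for \<theta>
  proof -
    have "cmod (1 - cis \<theta>) \<noteq> 0" using one_minus_cis_eq_0_iff[of \<theta>] that by auto
    then have "sin (\<theta> / 2) \<noteq> 0" by (simp add: cmod_one_minus_cis)
    then show ?thesis by (simp add: H_def norm_divide norm_mult)
  qed
  ultimately show "\<exists>G. continuous_on UNIV G \<and> (\<forall>\<theta>. G (- \<theta>) = G \<theta>) \<and>
      (\<forall>\<theta>\<in>{0<..<pi}. G \<theta> = F (1 / (2 * sin (\<theta> / 2)))) \<and>
      (\<forall>\<theta>\<in>{-pi..pi} - {0}. G \<theta> = F (cmod (complex_of_real (1 / (2 * \<bar>sin (\<theta> / 2)\<bar>)))))"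
    by (intro exI[of _ ?G] conjI allI ballI) simp_all
qed (auto simp: singular_values_nest nest_angle_bounds[simplified] angle_strict_bounds)

lemma sv_distributed_cong:
  assumes "A \<sim>\<^sub>\<sigma> f" "\<And>\<theta>. cmod (g \<theta>) = cmod (f \<theta>)" "g \<in> borel_measurable (lebesgue_on {-pi..pi})"
  shows "A \<sim>\<^sub>\<sigma> g"
  using assms by (simp add: sv_distributed_def)

section \<open>Distributions of the two families\<close>

theorem mainTheorem5:
  shows
    "\<comment> \<open>(a)\<close>
     (set_integrable lebesgue {-pi..pi} (\<lambda>\<theta>. 1 + cis \<theta>) \<and>
      (\<forall>N\<ge>3. cmat (sw_mat N) = toeplitz_mat N (\<lambda>\<theta>. 1 + cis \<theta>)) \<and>
      (\<lambda>N. cmat (sw_mat N)) \<sim>\<^sub>G\<^sub>L\<^sub>T (\<lambda>(x, \<theta>). 1 + cis \<theta>) \<and>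
      (\<lambda>N. cmat (sw_mat N)) \<sim>\<^sub>\<sigma> (\<lambda>\<theta>. 1 + cis \<theta>)) \<and>
     \<comment> \<open>(b)\<close>
     (set_integrable lebesgue {-pi..pi} (\<lambda>\<theta>. 1 - cis \<theta>) \<and>
      (\<forall>N\<ge>3. invertible_mat (nest_mat N) \<and>
         cmat (mat_inv (nest_mat N)) = toeplitz_mat N (\<lambda>\<theta>. 1 - cis \<theta>)) \<and>
      (\<lambda>N. cmat (mat_inv (nest_mat N))) \<sim>\<^sub>G\<^sub>L\<^sub>T (\<lambda>(x, \<theta>). 1 - cis \<theta>)) \<and>
     \<comment> \<open>(c)\<close>
     ((\<forall>\<theta>\<in>{-pi..pi}. 1 - cis \<theta> = 0 \<longleftrightarrow> \<theta> = 0) \<and>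
      (AE \<theta> in lebesgue_on {-pi..pi}. 1 - cis \<theta> \<noteq> 0) \<and>
      (\<lambda>N. cmat (nest_mat N)) \<sim>\<^sub>G\<^sub>L\<^sub>T (\<lambda>(x, \<theta>). 1 / (1 - cis \<theta>)) \<and>
      (\<lambda>N. cmat (nest_mat N)) \<sim>\<^sub>\<sigma> (\<lambda>\<theta>. 1 / (1 - cis \<theta>))) \<and>
     \<comment> \<open>(d)\<close>
     ((\<forall>\<theta>\<in>{-pi..pi}. cmod (1 + cis \<theta>) = 2 * \<bar>cos (\<theta> / 2)\<bar>) \<and>
      (\<forall>\<theta>\<in>{-pi..pi} - {0}. cmod (1 / (1 - cis \<theta>)) = 1 / (2 * \<bar>sin (\<theta> / 2)\<bar>)) \<and>
      (\<lambda>N. cmat (sw_mat N)) \<sim>\<^sub>\<sigma> (\<lambda>\<theta>. complex_of_real (2 * \<bar>cos (\<theta> / 2)\<bar>)) \<and>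
      (\<lambda>N. cmat (nest_mat N)) \<sim>\<^sub>\<sigma> (\<lambda>\<theta>. complex_of_real (1 / (2 * \<bar>sin (\<theta> / 2)\<bar>))))"
proof (intro conjI)
  have "set_integrable lebesgue {-pi..pi} (\<lambda>\<theta>. 1 :: complex)"
    using set_integrable_cis[of 0] by simp
  moreover have "set_integrable lebesgue {-pi..pi} cis"
    using set_integrable_cis[of 1] by simp
  ultimately show "set_integrable lebesgue {-pi..pi} (\<lambda>\<theta>. 1 + cis \<theta>)"
    and "set_integrable lebesgue {-pi..pi} (\<lambda>\<theta>. 1 - cis \<theta>)"
    by (auto intro: set_integral_add set_integral_diff)
  show "\<forall>N\<ge>3. cmat (sw_mat N) = toeplitz_mat N (\<lambda>\<theta>. 1 + cis \<theta>)"
    using toeplitz_mat_linear_symbol[of _ 1 1] by (simp add: cmat_sw_mat_eq)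
  show "\<forall>N\<ge>3. invertible_mat (nest_mat N) \<and>
      cmat (mat_inv (nest_mat N)) = toeplitz_mat N (\<lambda>\<theta>. 1 - cis \<theta>)"
    using toeplitz_mat_linear_symbol[of _ 1 "-1"]
    by (simp add: cmat_mat_inv_nest_mat invertible_nest_mat flip: fps_const_neg)
  show "(\<lambda>N. cmat (sw_mat N)) \<sim>\<^sub>G\<^sub>L\<^sub>T (\<lambda>(x, \<theta>). 1 + cis \<theta>)"
    using glt_fps_toeplitz_poly[of "[:1, 1:]"]
    by (simp add: cmat_sw_mat_eq fps_of_poly_linear' case_prod_unfold)
  show "(\<lambda>N. cmat (mat_inv (nest_mat N))) \<sim>\<^sub>G\<^sub>L\<^sub>T (\<lambda>(x, \<theta>). 1 - cis \<theta>)"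
    using glt_fps_toeplitz_poly[of "[:1, -1:]"]
    by (simp add: cmat_mat_inv_nest_mat fps_of_poly_linear' case_prod_unfold flip: fps_const_neg)
  show "(\<lambda>N. cmat (nest_mat N)) \<sim>\<^sub>G\<^sub>L\<^sub>T (\<lambda>(x, \<theta>). 1 / (1 - cis \<theta>))"
    using glt_nest by (simp add: cmat_nest_mat_eq)
  show nonzero: "\<forall>\<theta>\<in>{-pi..pi}. 1 - cis \<theta> = 0 \<longleftrightarrow> \<theta> = 0"
    using one_minus_cis_eq_0_iff by blast
  show "AE \<theta> in lebesgue_on {-pi..pi}. 1 - cis \<theta> \<noteq> 0"
    using nonzero AE_lebesgue_nonzero by (auto simp: AE_restrict_space_iff elim!: eventually_mono)
  show "\<forall>\<theta>\<in>{-pi..pi}. cmod (1 + cis \<theta>) = 2 * \<bar>cos (\<theta> / 2)\<bar>"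
    by (simp add: cmod_one_plus_cis)
  show "\<forall>\<theta>\<in>{-pi..pi} - {0}. cmod (1 / (1 - cis \<theta>)) = 1 / (2 * \<bar>sin (\<theta> / 2)\<bar>)"
    by (simp add: norm_divide cmod_one_minus_cis)
  show "(\<lambda>N. cmat (sw_mat N)) \<sim>\<^sub>\<sigma> (\<lambda>\<theta>. complex_of_real (2 * \<bar>cos (\<theta> / 2)\<bar>))"
    by (rule sw_distributed)
  then show "(\<lambda>N. cmat (sw_mat N)) \<sim>\<^sub>\<sigma> (\<lambda>\<theta>. 1 + cis \<theta>)"
    by (rule sv_distributed_cong)
      (auto simp: cmod_one_plus_cis norm_mult
        intro!: borel_measurable_lebesgue_onI borel_measurable_continuous_onI continuous_intros)
  show "(\<lambda>N. cmat (nest_mat N)) \<sim>\<^sub>\<sigma> (\<lambda>\<theta>. complex_of_real (1 / (2 * \<bar>sin (\<theta> / 2)\<bar>)))"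
    by (rule nest_distributed)
  have "(\<lambda>\<theta>. 1 / (1 - cis \<theta>)) \<in> borel_measurable (lebesgue_on {-pi..pi})"
    by (rule borel_measurable_lebesgue_onI, rule borel_measurable_divide)
      (intro borel_measurable_continuous_onI continuous_intros)+
  then show "(\<lambda>N. cmat (nest_mat N)) \<sim>\<^sub>\<sigma> (\<lambda>\<theta>. 1 / (1 - cis \<theta>))"
    by (intro sv_distributed_cong[OF nest_distributed])
      (simp_all add: cmod_one_minus_cis norm_divide norm_mult)
qed

end
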